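(* Let $\Omega\subset\mathfrak{P}_n$ be a spectrally saturated open set, and let $U=\mathfrak{S}(\Omega)$. The space $\mathcal{R}_{s,n}(\Omega)$ is a unital commutative $\mathbb{R}$-algebra, the space $\mathcal{R}_s(\Omega,\mathfrak{C}_n)$ is a right $\mathcal{R}_{s,n}(\Omega)$-module, the linear map $$\mathcal{O}_s(U,\mathfrak{K}_n)\ni F\mapsto F_\sigma\in\mathcal{R}_s(\Omega,\mathfrak{C}_n)$$ is a right module isomorphism, and its restriction $$\mathcal{O}_s(U)\ni f\mapsto f_\sigma\in\mathcal{R}_{s,n}(\Omega)$$ is an $\mathbb{R}$-algebra isomorphism. Moreover, for every polynomial $P(\zeta)=\sum_{k=0}^m a_k\zeta^k$, $\zeta\in\mathbb{C}$, with $a_k\in\mathfrak{C}_n$ for all $k=0,1,\dots,m$, we have $P_\sigma(\kappa)=\sum_{k=0}^m a_k\kappa^k\in\mathfrak{C}_n$ for all $\kappa\in\mathfrak{P}_n$.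
   Context: $n\ge0$ is a fixed integer. $\mathfrak{C}_n$ is the unital associative real algebra generated by $e_0=1,e_1,\dots,e_n$ with $e_j^2=-1$, $e_je_k=-e_ke_j$ ($j,k=1,\dots,n$, $j\ne k$), with basis $e_J=e_{j_1}\cdots e_{j_p}$ for $J=\{j_1<\dots<j_p\}\subset\{1,\dots,n\}$, $e_\emptyset=1$. $\mathfrak{P}_n=\mathrm{span}_{\mathbb R}\{1,e_1,\dots,e_n\}\cong\mathbb{R}^{n+1}$ is the space of paravectors. For $\kappa=a_0+\sum_{k=1}^n a_ke_k\in\mathfrak{P}_n$: $\Re(\kappa)=a_0$, $\Im(\kappa)=\sum_{k\ge1}a_ke_k$, $|\kappa|^2=\sum_{k\ge0}a_k^2$. $\mathfrak{K}_n=\mathbb{C}\otimes_{\mathbb R}\mathfrak{C}_n=\mathfrak{C}_n+i\mathfrak{C}_n$ (complex numbers are central), with conjugation $\overline{\mathbf a+i\mathbf b}=\mathbf a-i\mathbf b$ for $\mathbf a,\mathbf b\in\mathfrak{C}_n$. The spectrum of $\kappa\in\mathfrak{P}_n$ in $\mathfrak{K}_n$ is $\sigma(\kappa)=\{s_+(\kappa),s_-(\kappa)\}$, $s_\pm(\kappa)=\Re(\kappa)\pm i|\Im(\kappa)|$. A set $A\subset\mathfrak{P}_n$ is spectrally saturated if $\theta\in\mathfrak{P}_n$, $\kappa\in A$, $\sigma(\theta)=\sigma(\kappa)$ imply $\theta\in A$. $\mathfrak{S}(\Omega)=\bigcup_{\kappa\in\Omega}\sigma(\kappa)\subset\mathbb{C}$,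 so $U=\mathfrak{S}(\Omega)$ is conjugate symmetric ($\zeta\in U\iff\bar\zeta\in U$), and also open. $\mathcal{O}_s(U,\mathfrak{K}_n)$ is the set of analytic functions $F:U\to\mathfrak{K}_n$ with $F(\bar\zeta)=\overline{F(\zeta)}$ for all $\zeta\in U$ (analytic stem functions); $\mathcal{O}_s(U)$ is the real subalgebra of those that are $\mathbb{C}$-valued. For $F\in\mathcal{O}_s(U,\mathfrak{K}_n)$ and $\kappa\in\Omega\setminus\mathbb{R}$, with $\mathfrak{s}=\Im(\kappa)/|\Im(\kappa)|$, $F_\sigma(\kappa)=F(s_+(\kappa))\frac{1-i\mathfrak{s}}{2}+F(s_-(\kappa))\frac{1+i\mathfrak{s}}{2}$, and $F_\sigma(r)=F(r)$ for $r\in\Omega\cap\mathbb{R}$. (Equivalently, $F_\sigma(\kappa)=\frac1{2\pi i}\int_\Gamma F(\zeta)(\zeta-\kappa)^{-1}d\zeta$, with $\Gamma$ the boundary of a Cauchy domain in $U$ containing $\sigma(\kappa)$, i.e. of a bounded open set $\Delta$ with $\overline\Delta\subset U$ whose boundary consists of finitely many closed, piecewise smooth, positively oriented curves.) $\mathcal{R}_s(\Omega,\mathfrak{C}_n)=\{F_\sigma:F\in\mathcal{O}_s(U,\mathfrak{K}_n)\}$ and $\mathcal{R}_{s,n}(\Omega)=\{f_\sigma:f\in\mathcal{O}_s(U)\}$, with pointwise operations. $\mathcal{O}_s(U,\mathfrak{K}_n)$ is a right $\mathcal{O}_s(U)$-module under pointwise multiplication; "right module isomorphism" means an $\mathbb{R}$-linear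 bijection with $(Ff)_\sigma=F_\sigma f_\sigma$ for $F\in\mathcal{O}_s(U,\mathfrak{K}_n)$, $f\in\mathcal{O}_s(U)$. In the last assertion $P$ is regarded as a stem function on $\mathbb{C}$. *)

theory Defs
  imports
    "HOL-Analysis.Analysis"
    "HOL-Algebra.QuotRing"
    "HOL-Algebra.Module"
    "HOL-Library.Type_Length"
begin

section \<open>The complexified Clifford algebra\<close>

text \<open>
  The number of generators is \<open>n = LENGTH('n)\<close>; every natural number, including
  \<open>0\<close>, is the length of some type of class \<^class>\<open>len0\<close>.
  An element is stored through its complex coordinates with respect to the basis \<open>e\<^sub>J\<close>,
  \<open>J \<subseteq> {1..n}\<close>.
\<close>

abbreviation gens :: "'n::len0 itself \<Rightarrow> nat set" where
  "gens _ \<equiv> {1..LENGTH('n)}"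

typedef (overloaded) ('n::len0) cclifford =
  "{f :: nat set \<Rightarrow> complex. \<forall>J. \<not> J \<subseteq> gens TYPE('n) \<longrightarrow> f J = 0}"
  morphisms coeff Abs_cclifford
  by (rule exI[of _ "\<lambda>_. 0"]) simp

setup_lifting type_definition_cclifford

lemma cclifford_eqI:
  fixes x y :: "'n::len0 cclifford"
  assumes "\<And>J. J \<subseteq> gens TYPE('n) \<Longrightarrow> coeff x J = coeff y J"
  shows "x = y"
  using assms by transfer (metis ext)

lemma coeff_outside: "\<not> J \<subseteq> gens TYPE('n) \<Longrightarrow> coeff (x :: 'n::len0 cclifford) J = 0"
  by transfer blast

text \<open>
  \<open>e\<^sub>J e\<^sub>K = \<plusminus> e\<^sub>L\<close> with \<open>L\<close> the symmetric difference of \<open>J\<close> and \<open>K\<close>: sorting the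
  generators costs one sign for each pair \<open>k < j\<close>, and each \<open>e\<^sub>j\<^sup>2 = -1\<close> costs one
  for \<open>k = j\<close>.
\<close>

definition blade_sgn :: "nat set \<Rightarrow> nat set \<Rightarrow> complex" where
  "blade_sgn J K = (-1) ^ card {(j, k). j \<in> J \<and> k \<in> K \<and> k \<le> j}"

instantiation cclifford :: (len0) "{zero, one, plus, minus, uminus, times, scaleR, norm}"
begin

lift_definition zero_cclifford :: "'a cclifford" is "\<lambda>_. 0" by simp

lift_definition one_cclifford :: "'a cclifford" is "\<lambda>J. if J = {} then 1 else 0" by auto

lift_definition plus_cclifford :: "'a cclifford \<Rightarrow> 'a cclifford \<Rightarrow> 'a cclifford"
  is "\<lambda>f g J. f J + g J" by simp

lift_definition minus_cclifford :: "'a cclifford \<Rightarrow> 'a cclifford \<Rightarrow> 'a cclifford"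
  is "\<lambda>f g J. f J - g J" by simp

lift_definition uminus_cclifford :: "'a cclifford \<Rightarrow> 'a cclifford"
  is "\<lambda>f J. - f J" by simp

lift_definition times_cclifford :: "'a cclifford \<Rightarrow> 'a cclifford \<Rightarrow> 'a cclifford"
  is "\<lambda>f g L. \<Sum>J \<in> Pow (gens TYPE('a)). \<Sum>K \<in> Pow (gens TYPE('a)).
        if sym_diff J K = L then blade_sgn J K * f J * g K else 0"
  by (intro allI impI sum.neutral ballI if_not_P) blast

lift_definition scaleR_cclifford :: "real \<Rightarrow> 'a cclifford \<Rightarrow> 'a cclifford"
  is "\<lambda>r f J. r *\<^sub>R f J" by simp

definition norm_cclifford :: "'a cclifford \<Rightarrow> real" where
  "norm_cclifford x = L2_set (\<lambda>J. cmod (coeff x J)) (Pow (gens TYPE('a)))"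

instance ..

end

lemma coeff_simps [simp]:
  "coeff 0 J = 0"
  "coeff 1 J = (if J = {} then 1 else 0)"
  "coeff (x + y) J = coeff x J + coeff y J"
  "coeff (x - y) J = coeff x J - coeff y J"
  "coeff (- x) J = - coeff x J"
  "coeff (r *\<^sub>R x) J = r *\<^sub>R coeff x J"
  by (transfer, simp)+

lemma coeff_times:
  "coeff (x * y :: 'n::len0 cclifford) L =
     (\<Sum>J \<in> Pow (gens TYPE('n)). \<Sum>K \<in> Pow (gens TYPE('n)).
        if sym_diff J K = L then blade_sgn J K * coeff x J * coeff y K else 0)"
  by transfer simp

lemma finite_blade_pairs:
  "finite J \<Longrightarrow> finite K \<Longrightarrow> finite {(j, k). j \<in> J \<and> k \<in> K \<and> k \<le> (j::nat)}"
  by (rule finite_subset[of _ "J \<times> K"]) auto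

lemma minus_one_power_card_sym_diff:
  assumes "finite A" "finite B"
  shows "(-1 :: complex) ^ card (sym_diff A B) = (-1) ^ card A * (-1) ^ card B"
proof -
  have 1: "card (sym_diff A B) = card (A - B) + card (B - A)"
    using assms by (intro card_Un_disjoint) auto
  have 2: "card A = card (A - B) + card (A \<inter> B)"
    using assms by (subst card_Un_disjoint[symmetric]) (auto intro: arg_cong[of _ _ card])
  have 3: "card B = card (B - A) + card (A \<inter> B)"
    using assms by (subst card_Un_disjoint[symmetric]) (auto intro: arg_cong[of _ _ card])
  have "(-1 :: complex) ^ card (A \<inter> B) * (-1) ^ card (A \<inter> B) = 1"
    by (simp flip: power_add mult_2)
  then show ?thesis by (simp add: 1 2 3 power_add algebra_simps)
qed

lemma blade_sgn_sym_diff_left: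
  assumes "finite J" "finite K" "finite L"
  shows "blade_sgn (sym_diff J K) L = blade_sgn J L * blade_sgn K L"
proof -
  have "{(j, k). j \<in> sym_diff J K \<and> k \<in> L \<and> k \<le> j} =
    sym_diff {(j, k). j \<in> J \<and> k \<in> L \<and> k \<le> j} {(j, k). j \<in> K \<and> k \<in> L \<and> k \<le> j}"
    by auto
  then show ?thesis
    unfolding blade_sgn_def
    by (simp add: minus_one_power_card_sym_diff finite_blade_pairs assms)
qed

lemma blade_sgn_sym_diff_right:
  assumes "finite J" "finite K" "finite L"
  shows "blade_sgn J (sym_diff K L) = blade_sgn J K * blade_sgn J L"
proof -
  have "{(j, k). j \<in> J \<and> k \<in> sym_diff K L \<and> k \<le> j} =
    sym_diff {(j, k). j \<in> J \<and> k \<in> K \<and> k \<le> j} {(j, k). j \<in> J \<and> k \<in> L \<and> k \<le> j}"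
    by auto
  then show ?thesis
    unfolding blade_sgn_def
    by (simp add: minus_one_power_card_sym_diff finite_blade_pairs assms)
qed

lemma blade_sgn_empty [simp]: "blade_sgn {} K = 1" "blade_sgn J {} = 1"
  by (simp_all add: blade_sgn_def)

lemma cclifford_mult_assoc: "(x * y) * z = x * (y * z)" for x y z :: "'n::len0 cclifford"
proof (rule cclifford_eqI)
  fix L assume "L \<subseteq> gens TYPE('n)"
  define P where "P = Pow (gens TYPE('n))"
  have [simp]: "finite P" by (simp add: P_def)
  have fin: "finite J" if "J \<in> P" for J
    using that by (auto simp: P_def intro: finite_subset)
  have clos: "sym_diff J K \<in> P" if "J \<in> P" "K \<in> P" for J K
    using that by (auto simp: P_def)
  define T where "T = (\<lambda>J K M. if sym_diff (sym_diff J K) M = L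
    then blade_sgn J K * blade_sgn (sym_diff J K) M * coeff x J * coeff y K * coeff z M else 0)"
  have "coeff ((x * y) * z) L = (\<Sum>N\<in>P. \<Sum>M\<in>P. \<Sum>J\<in>P. \<Sum>K\<in>P.
      if sym_diff J K = N then T J K M else 0)"
    unfolding coeff_times P_def[symmetric]
  proof (intro sum.cong refl)
    fix N M
    show "(if sym_diff N M = L then blade_sgn N M * (\<Sum>J\<in>P. \<Sum>K\<in>P. if sym_diff J K = N
        then blade_sgn J K * coeff x J * coeff y K else 0) * coeff z M else 0) =
      (\<Sum>J\<in>P. \<Sum>K\<in>P. if sym_diff J K = N then T J K M else 0)"
    proof (cases "sym_diff N M = L")
      case True
      then show ?thesis
        unfolding sum_distrib_left sum_distrib_right if_P[OF True]
        by (intro sum.cong refl) (simp add: T_def)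
    next
      case False
      have "(if sym_diff J K = N then T J K M else 0) = 0" for J K
        using False by (simp add: T_def)
      then show ?thesis using False by (simp only: if_False sum.neutral_const)
    qed
  qed
  also have "\<dots> = (\<Sum>M\<in>P. \<Sum>J\<in>P. \<Sum>K\<in>P. \<Sum>N\<in>P. if sym_diff J K = N then T J K M else 0)"
  proof -
    have "(\<Sum>N\<in>P. \<Sum>M\<in>P. \<Sum>J\<in>P. \<Sum>K\<in>P. g N M J K) = (\<Sum>M\<in>P. \<Sum>J\<in>P. \<Sum>K\<in>P. \<Sum>N\<in>P. g N M J K)"
      for g :: "_ \<Rightarrow> _ \<Rightarrow> _ \<Rightarrow> _ \<Rightarrow> complex"
      by (subst sum.swap, rule sum.cong[OF refl], subst sum.swap, rule sum.cong[OF refl],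
          subst sum.swap, rule refl)
    then show ?thesis .
  qed
  also have "\<dots> = (\<Sum>M\<in>P. \<Sum>J\<in>P. \<Sum>K\<in>P. T J K M)"
    by (intro sum.cong refl) (simp add: clos)
  also have "\<dots> = (\<Sum>J\<in>P. \<Sum>K\<in>P. \<Sum>M\<in>P. T J K M)"
    by (subst sum.swap, rule sum.cong[OF refl], subst sum.swap, rule refl)
  also have "\<dots> = (\<Sum>J\<in>P. \<Sum>K\<in>P. \<Sum>M\<in>P. if sym_diff J (sym_diff K M) = L
      then blade_sgn J (sym_diff K M) * coeff x J * (blade_sgn K M * coeff y K * coeff z M) else 0)"
  proof (intro sum.cong refl)
    fix J K M assume "J \<in> P" "K \<in> P" "M \<in> P"
    then have "blade_sgn J K * blade_sgn (sym_diff J K) M = blade_sgn J (sym_diff K M) * blade_sgn K M"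
      using fin blade_sgn_sym_diff_left[of J K M] blade_sgn_sym_diff_right[of J K M] by simp
    then have "blade_sgn J K * blade_sgn (sym_diff J K) M * coeff x J * coeff y K * coeff z M =
      blade_sgn J (sym_diff K M) * coeff x J * (blade_sgn K M * coeff y K * coeff z M)"
      by (simp add: mult_ac)
    moreover have "sym_diff (sym_diff J K) M = sym_diff J (sym_diff K M)"
      by auto
    ultimately show "T J K M = (if sym_diff J (sym_diff K M) = L
      then blade_sgn J (sym_diff K M) * coeff x J * (blade_sgn K M * coeff y K * coeff z M) else 0)"
      by (simp add: T_def)
  qed
  also have "\<dots> = (\<Sum>J\<in>P. \<Sum>K\<in>P. \<Sum>M\<in>P. \<Sum>N\<in>P. if sym_diff K M = N then (if sym_diff J N = L
      then blade_sgn J N * coeff x J * (blade_sgn K M * coeff y K * coeff z M) else 0) else 0)"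
    by (intro sum.cong refl) (simp add: clos)
  also have "\<dots> = (\<Sum>J\<in>P. \<Sum>N\<in>P. \<Sum>K\<in>P. \<Sum>M\<in>P. if sym_diff K M = N then (if sym_diff J N = L
      then blade_sgn J N * coeff x J * (blade_sgn K M * coeff y K * coeff z M) else 0) else 0)"
  proof -
    have swap: "(\<Sum>K\<in>P. \<Sum>M\<in>P. \<Sum>N\<in>P. g K M N) = (\<Sum>N\<in>P. \<Sum>K\<in>P. \<Sum>M\<in>P. g K M N)"
      for g :: "_ \<Rightarrow> _ \<Rightarrow> _ \<Rightarrow> complex"
    proof -
      have "(\<Sum>K\<in>P. \<Sum>M\<in>P. \<Sum>N\<in>P. g K M N) = (\<Sum>K\<in>P. \<Sum>N\<in>P. \<Sum>M\<in>P. g K M N)"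
        by (rule sum.cong[OF refl], rule sum.swap)
      also have "\<dots> = (\<Sum>N\<in>P. \<Sum>K\<in>P. \<Sum>M\<in>P. g K M N)"
        by (rule sum.swap)
      finally show ?thesis .
    qed
    show ?thesis by (rule sum.cong[OF refl], rule swap)
  qed
  also have "\<dots> = coeff (x * (y * z)) L"
    unfolding coeff_times P_def[symmetric]
  proof (intro sum.cong refl)
    fix J N
    show "(\<Sum>K\<in>P. \<Sum>M\<in>P. if sym_diff K M = N then (if sym_diff J N = L
        then blade_sgn J N * coeff x J * (blade_sgn K M * coeff y K * coeff z M) else 0) else 0) =
      (if sym_diff J N = L then blade_sgn J N * coeff x J * (\<Sum>K\<in>P. \<Sum>M\<in>P. if sym_diff K M = N
        then blade_sgn K M * coeff y K * coeff z M else 0) else 0)"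
    proof (cases "sym_diff J N = L")
      case True
      then show ?thesis
        unfolding sum_distrib_left if_P[OF True]
        by (intro sum.cong refl) simp
    next
      case False
      then show ?thesis by (simp only: if_False if_cancel sum.neutral_const)
    qed
  qed
  finally show "coeff ((x * y) * z) L = coeff (x * (y * z)) L" .
qed

lemma coeff_scalar_times_left:
  assumes "\<And>J. J \<noteq> {} \<Longrightarrow> coeff (c :: 'n::len0 cclifford) J = 0"
  shows "coeff (c * x) L = coeff c {} * coeff x L"
proof (cases "L \<subseteq> gens TYPE('n)")
  case True
  have "coeff (c * x) L = (\<Sum>J \<in> Pow (gens TYPE('n)). if J = {} then
      \<Sum>K \<in> Pow (gens TYPE('n)). if K = L then coeff c {} * coeff x L else 0 else 0)"
    unfolding coeff_times
  proof (intro sum.cong refl)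
    fix J
    show "(\<Sum>K \<in> Pow (gens TYPE('n)). if sym_diff J K = L then blade_sgn J K * coeff c J * coeff x K else 0) =
      (if J = {} then \<Sum>K \<in> Pow (gens TYPE('n)). if K = L then coeff c {} * coeff x L else 0 else 0)"
      by (cases "J = {}") (simp_all add: assms cong: if_cong)
  qed
  with True show ?thesis by simp
qed (simp add: coeff_outside)

lemma coeff_scalar_times_right:
  assumes "\<And>J. J \<noteq> {} \<Longrightarrow> coeff (c :: 'n::len0 cclifford) J = 0"
  shows "coeff (x * c) L = coeff x L * coeff c {}"
proof (cases "L \<subseteq> gens TYPE('n)")
  case True
  have "coeff (x * c) L = (\<Sum>J \<in> Pow (gens TYPE('n)). if J = L then
      \<Sum>K \<in> Pow (gens TYPE('n)). if K = {} then coeff x L * coeff c {} else 0 else 0)"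
    unfolding coeff_times
  proof (intro sum.cong refl)
    fix J
    have "(if sym_diff J K = L then blade_sgn J K * coeff x J * coeff c K else 0) =
      (if K = {} then if J = L then coeff x L * coeff c {} else 0 else 0)" for K
      by (cases "K = {}") (simp_all add: assms)
    then show "(\<Sum>K \<in> Pow (gens TYPE('n)). if sym_diff J K = L then blade_sgn J K * coeff x J * coeff c K else 0) =
      (if J = L then \<Sum>K \<in> Pow (gens TYPE('n)). if K = {} then coeff x L * coeff c {} else 0 else 0)"
      by (simp only:) simp
  qed
  with True show ?thesis by simp
qed (simp add: coeff_outside)

instance cclifford :: (len0) real_algebra_1
proof
  fix x y z :: "'a cclifford" and a b :: real
  show "x * y * z = x * (y * z)" by (rule cclifford_mult_assoc)
  show "(x + y) * z = x * z + y * z"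
    by (rule cclifford_eqI)
      (auto simp: coeff_times algebra_simps simp flip: sum.distrib intro!: sum.cong)
  show "x * (y + z) = x * y + x * z"
    by (rule cclifford_eqI)
      (auto simp: coeff_times algebra_simps simp flip: sum.distrib intro!: sum.cong)
  show "a *\<^sub>R x * y = a *\<^sub>R (x * y)" "x * a *\<^sub>R y = a *\<^sub>R (x * y)"
    by (rule cclifford_eqI,
        auto simp: coeff_times scaleR_conv_of_real sum_distrib_left algebra_simps intro!: sum.cong)+
  show "1 * x = x" "x * 1 = x"
    by (rule cclifford_eqI, simp add: coeff_scalar_times_left coeff_scalar_times_right)+
  have "coeff (0 :: 'a cclifford) {} \<noteq> coeff (1 :: 'a cclifford) {}" by simp
  then show "(0 :: 'a cclifford) \<noteq> 1" by metis
qed (rule cclifford_eqI, simp add: algebra_simps)+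

instantiation cclifford :: (len0) real_normed_vector
begin

definition dist_cclifford :: "'a cclifford \<Rightarrow> 'a cclifford \<Rightarrow> real" where
  "dist_cclifford x y = norm (x - y)"

definition sgn_cclifford :: "'a cclifford \<Rightarrow> 'a cclifford" where
  "sgn_cclifford x = x /\<^sub>R norm x"

definition uniformity_cclifford :: "('a cclifford \<times> 'a cclifford) filter" where
  "uniformity_cclifford = (INF e\<in>{0 <..}. principal {(x, y). dist x y < e})"

definition open_cclifford :: "'a cclifford set \<Rightarrow> bool" where
  "open_cclifford S = (\<forall>x\<in>S. \<forall>\<^sub>F (x', y) in uniformity. x' = x \<longrightarrow> y \<in> S)"

instance
proof
  fix x y :: "'a cclifford" and r :: real
  show "(norm x = 0) = (x = 0)"
    by (auto simp: norm_cclifford_def L2_set_eq_0_iff intro: cclifford_eqI)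
  show "norm (x + y) \<le> norm x + norm y"
    unfolding norm_cclifford_def
    by (rule order.trans[OF L2_set_mono L2_set_triangle_ineq]) (auto intro: norm_triangle_ineq)
  show "norm (r *\<^sub>R x) = \<bar>r\<bar> * norm x"
    by (simp add: norm_cclifford_def L2_set_right_distrib)
qed (fact dist_cclifford_def sgn_cclifford_def uniformity_cclifford_def open_cclifford_def)+

end

lift_definition blade :: "nat set \<Rightarrow> 'n::len0 cclifford"
  is "\<lambda>J L. if L = J \<and> J \<subseteq> gens TYPE('n) then 1 else 0" by auto

abbreviation gen :: "nat \<Rightarrow> 'n::len0 cclifford" where
  "gen j \<equiv> blade {j}"

lift_definition of_cx :: "complex \<Rightarrow> 'n::len0 cclifford"
  is "\<lambda>c J. if J = {} then c else 0" by auto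

lift_definition cconj :: "'n::len0 cclifford \<Rightarrow> 'n cclifford"
  is "\<lambda>f J. cnj (f J)" by simp

definition clifford_real :: "'n::len0 cclifford set" where
  "clifford_real = span (blade ` Pow (gens TYPE('n)))"

definition paravectors :: "'n::len0 cclifford set" where
  "paravectors = span (insert 1 (gen ` gens TYPE('n)))"


subsection \<open>The defining properties of the algebra\<close>

lemma coeff_blade: "coeff (blade J :: 'n::len0 cclifford) L =
    (if L = J \<and> J \<subseteq> gens TYPE('n) then 1 else 0)"
  by transfer simp

lemma coeff_of_cx: "coeff (of_cx c) J = (if J = {} then c else 0)"
  by transfer simp

lemma coeff_cconj: "coeff (cconj x) J = cnj (coeff x J)"
  by transfer simp

lemma coeff_sum: "coeff (sum f A) J = (\<Sum>a\<in>A. coeff (f a) J)"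
  by (induction A rule: infinite_finite_induct) auto

lemma blade_times_blade:
  assumes "J \<subseteq> gens TYPE('n::len0)" "K \<subseteq> gens TYPE('n)"
  shows "blade J * blade K = (of_cx (blade_sgn J K) * blade (sym_diff J K) :: 'n cclifford)"
proof (rule cclifford_eqI)
  fix L
  have "coeff (blade J * blade K :: 'n cclifford) L =
    (\<Sum>A \<in> Pow (gens TYPE('n)). if A = J then \<Sum>B \<in> Pow (gens TYPE('n)). if B = K
       then if sym_diff J K = L then blade_sgn J K else 0 else 0 else 0)"
    unfolding coeff_times
  proof (intro sum.cong refl)
    fix A
    have "(if sym_diff A B = L then blade_sgn A B * coeff (blade J :: 'n cclifford) A *
        coeff (blade K :: 'n cclifford) B else 0) =
      (if B = K then if A = J then if sym_diff J K = L then blade_sgn J K else 0 else 0 else 0)" for B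
      by (cases "A = J"; cases "B = K") (use assms in \<open>simp_all add: coeff_blade\<close>)
    then show "(\<Sum>B \<in> Pow (gens TYPE('n)). if sym_diff A B = L
        then blade_sgn A B * coeff (blade J :: 'n cclifford) A * coeff (blade K :: 'n cclifford) B else 0) =
      (if A = J then \<Sum>B \<in> Pow (gens TYPE('n)). if B = K
         then if sym_diff J K = L then blade_sgn J K else 0 else 0 else 0)"
      by (simp only:) simp
  qed
  also have "\<dots> = (if sym_diff J K = L then blade_sgn J K else 0)"
    using assms by simp
  also have "\<dots> = coeff (of_cx (blade_sgn J K) * blade (sym_diff J K) :: 'n cclifford) L"
    using assms by (subst coeff_scalar_times_left) (auto simp: coeff_of_cx coeff_blade)
  finally show "coeff (blade J * blade K :: 'n cclifford) L =
    coeff (of_cx (blade_sgn J K) * blade (sym_diff J K) :: 'n cclifford) L" .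
qed

lemma of_cx_one [simp]: "of_cx 1 = 1"
  by (rule cclifford_eqI) (simp add: coeff_of_cx)

lemma of_cx_minus [simp]: "of_cx (- c) = - of_cx c"
  by (rule cclifford_eqI) (simp add: coeff_of_cx)

lemma of_cx_add: "of_cx (c + d) = of_cx c + of_cx d"
  by (rule cclifford_eqI) (simp add: coeff_of_cx)

lemma of_cx_mult: "of_cx (c * d) = of_cx c * of_cx d"
  by (rule cclifford_eqI) (subst coeff_scalar_times_left, auto simp: coeff_of_cx)

lemma coeff_of_real: "coeff (of_real r) J = (if J = {} then of_real r else 0)"
  unfolding of_real_def by (simp add: complex_eq_iff)

lemma of_cx_of_real: "of_cx (of_real r) = of_real r"
  by (rule cclifford_eqI) (simp add: coeff_of_cx coeff_of_real)

lemma of_cx_central: "of_cx c * x = x * of_cx c"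
  by (rule cclifford_eqI)
    (subst coeff_scalar_times_left, simp add: coeff_of_cx,
     subst coeff_scalar_times_right, auto simp: coeff_of_cx)

lemma blade_empty: "blade {} = 1"
  by (rule cclifford_eqI) (simp add: coeff_blade)

lemma gen_square:
  assumes "j \<in> gens TYPE('n::len0)"
  shows "gen j * gen j = (- 1 :: 'n cclifford)"
proof -
  have "{(i, k). i \<in> {j} \<and> k \<in> {j} \<and> k \<le> i} = {(j, j)}" by auto
  then have "blade_sgn {j} {j} = - 1" by (simp add: blade_sgn_def)
  then show ?thesis using assms by (simp add: blade_times_blade blade_empty)
qed

lemma gen_anticommute:
  assumes "j \<in> gens TYPE('n::len0)" "k \<in> gens TYPE('n)" "j \<noteq> k"
  shows "gen j * gen k = (- (gen k * gen j) :: 'n cclifford)"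
proof -
  have *: "blade_sgn {a} {b} = (if b \<le> a then - 1 else 1)" for a b
  proof -
    have "{(i, l). i \<in> {a} \<and> l \<in> {b} \<and> l \<le> i} = (if b \<le> a then {(a, b)} else {})" by auto
    then show ?thesis by (simp add: blade_sgn_def)
  qed
  have "sym_diff {k} {j} = sym_diff {j} {k}" by auto
  then have "blade (sym_diff {k} {j}) = (blade (sym_diff {j} {k}) :: 'n cclifford)"
    by (rule arg_cong)
  then show ?thesis using assms(3)
    by (subst (1 2) blade_times_blade) (use assms in \<open>auto simp: *\<close>)
qed

lemma blade_eq_prod_list:
  assumes "J \<subseteq> gens TYPE('n::len0)"
  shows "(blade J :: 'n cclifford) = prod_list (map gen (sorted_list_of_set J))"
proof -
  have "(blade (set js) :: 'n cclifford) = prod_list (map gen js)"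
    if "sorted_wrt (<) js" "set js \<subseteq> gens TYPE('n)" for js
    using that
  proof (induction js)
    case Nil
    then show ?case by (simp add: blade_empty)
  next
    case (Cons j js)
    then have lt: "\<forall>k\<in>set js. j < k" by simp
    then have "{(i, k). i \<in> {j} \<and> k \<in> set js \<and> k \<le> i} = {}" by auto
    then have s: "blade_sgn {j} (set js) = 1"
      unfolding blade_sgn_def by (simp only: card.empty power_0)
    from lt have d: "sym_diff {j} (set js) = set (j # js)" by auto
    have "gen j * blade (set js) = (blade (set (j # js)) :: 'n cclifford)"
      using Cons.prems by (subst blade_times_blade) (simp_all only: s d of_cx_one mult_1, auto)
    with Cons show ?case by simp
  qed
  from this[of "sorted_list_of_set J"] show ?thesis
    using assms finite_subset[OF assms] by auto
qed

lemma clifford_real_iff: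
  "(x :: 'n::len0 cclifford) \<in> clifford_real \<longleftrightarrow> (\<forall>J. coeff x J \<in> \<real>)"
proof
  assume "x \<in> clifford_real"
  then have "x \<in> span (blade ` Pow (gens TYPE('n)))" by (simp add: clifford_real_def)
  then show "\<forall>J. coeff x J \<in> \<real>"
    by (induction rule: span_induct_alt) (auto simp: coeff_blade complex_is_Real_iff)
next
  assume r: "\<forall>J. coeff x J \<in> \<real>"
  have "x = (\<Sum>J\<in>Pow (gens TYPE('n)). Re (coeff x J) *\<^sub>R blade J)"
  proof (rule cclifford_eqI)
    fix L assume L: "L \<subseteq> gens TYPE('n)"
    have "(\<Sum>J\<in>Pow (gens TYPE('n)). coeff (Re (coeff x J) *\<^sub>R blade J :: 'n cclifford) L) =
      (\<Sum>J\<in>Pow (gens TYPE('n)). if J = L then of_real (Re (coeff x L)) else 0)"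
      using L by (intro sum.cong refl) (simp add: coeff_blade complex_eq_iff)
    also have "\<dots> = coeff x L" using L r by simp
    finally show "coeff x L = coeff (\<Sum>J\<in>Pow (gens TYPE('n)). Re (coeff x J) *\<^sub>R (blade J :: 'n cclifford)) L"
      by (simp only: coeff_sum)
  qed
  also have "\<dots> \<in> clifford_real"
    unfolding clifford_real_def by (intro span_sum span_scale span_base) auto
  finally show "x \<in> clifford_real" .
qed

lemma ex1_complexification:
  "\<exists>!(a, b). a \<in> clifford_real \<and> b \<in> clifford_real \<and>
     (x :: 'n::len0 cclifford) = a + of_cx \<i> * b"
proof -
  have c: "coeff (of_cx \<i> * b) J = \<i> * coeff b J" for b :: "'n cclifford" and J
    by (subst coeff_scalar_times_left) (auto simp: coeff_of_cx)
  define a b where "a = (1/2) *\<^sub>R (x + cconj x)" and "b = (1/2) *\<^sub>R (of_cx \<i> * (cconj x - x))"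
  have ca: "coeff a J = of_real (Re (coeff x J))" and cb: "coeff b J = of_real (Im (coeff x J))" for J
    by (simp_all add: a_def b_def c coeff_cconj complex_eq_iff)
  show ?thesis
  proof (rule ex1I[of _ "(a, b)"])
    show "case (a, b) of (a, b) \<Rightarrow> a \<in> clifford_real \<and> b \<in> clifford_real \<and> x = a + of_cx \<i> * b"
      by (auto simp: clifford_real_iff ca cb c complex_eq_iff intro!: cclifford_eqI)
  next
    fix p assume "case p of (a, b) \<Rightarrow> a \<in> clifford_real \<and> b \<in> clifford_real \<and> x = a + of_cx \<i> * b"
    then obtain a' b' where p: "p = (a', b')" "a' \<in> clifford_real" "b' \<in> clifford_real"
      "x = a' + of_cx \<i> * b'" by auto
    have "coeff x J = coeff a' J + \<i> * coeff b' J" for J using p(4) by (simp add: c)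
    moreover have "Im (coeff a' J) = 0" "Im (coeff b' J) = 0" for J
      using p(2,3) by (auto simp: clifford_real_iff complex_is_Real_iff)
    ultimately have "coeff a' J = coeff a J" "coeff b' J = coeff b J" for J
      by (auto simp: ca cb complex_eq_iff)
    then show "p = (a, b)" using p(1) by (auto intro: cclifford_eqI)
  qed
qed

lemma cconj_complexification:
  assumes "a \<in> clifford_real" "b \<in> clifford_real"
  shows "cconj (a + of_cx \<i> * b) = a - of_cx \<i> * b"
proof (rule cclifford_eqI)
  fix J
  have c: "coeff (of_cx \<i> * b) J = \<i> * coeff b J"
    by (subst coeff_scalar_times_left) (auto simp: coeff_of_cx)
  have "cnj (coeff a J) = coeff a J" "cnj (coeff b J) = coeff b J"
    using assms by (auto simp: clifford_real_iff Reals_cnj_iff)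
  then show "coeff (cconj (a + of_cx \<i> * b)) J = coeff (a - of_cx \<i> * b) J"
    by (simp add: coeff_cconj c)
qed


section \<open>Paravectors and their spectra\<close>

definition re_part :: "'n::len0 cclifford \<Rightarrow> real" where
  "re_part \<kappa> = Re (coeff \<kappa> {})"

definition im_part :: "'n::len0 cclifford \<Rightarrow> 'n cclifford" where
  "im_part \<kappa> = (\<Sum>k\<in>gens TYPE('n). Re (coeff \<kappa> {k}) *\<^sub>R gen k)"

definition s_plus :: "'n::len0 cclifford \<Rightarrow> complex" where
  "s_plus \<kappa> = Complex (re_part \<kappa>) (norm (im_part \<kappa>))"

definition s_minus :: "'n::len0 cclifford \<Rightarrow> complex" where
  "s_minus \<kappa> = Complex (re_part \<kappa>) (- norm (im_part \<kappa>))"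

definition spectrum :: "'n::len0 cclifford \<Rightarrow> complex set" where
  "spectrum \<kappa> = {s_plus \<kappa>, s_minus \<kappa>}"

definition spectrally_saturated :: "'n::len0 cclifford set \<Rightarrow> bool" where
  "spectrally_saturated A \<longleftrightarrow> A \<subseteq> paravectors \<and>
     (\<forall>\<theta>\<in>paravectors. \<forall>\<kappa>\<in>A. spectrum \<theta> = spectrum \<kappa> \<longrightarrow> \<theta> \<in> A)"

definition spectra :: "'n::len0 cclifford set \<Rightarrow> complex set" where
  "spectra \<Omega> = (\<Union>\<kappa>\<in>\<Omega>. spectrum \<kappa>)"

lemma paravectorE:
  assumes "(\<kappa> :: 'n::len0 cclifford) \<in> paravectors"
  obtains a where "\<kappa> = of_real (a 0) + (\<Sum>k\<in>gens TYPE('n). a k *\<^sub>R gen k)"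
proof -
  from assms have "\<kappa> \<in> span (insert 1 (gen ` gens TYPE('n)))"
    by (simp add: paravectors_def)
  then have "\<exists>a. \<kappa> = of_real (a 0) + (\<Sum>k\<in>gens TYPE('n). a k *\<^sub>R gen k)"
  proof (induction rule: span_induct_alt)
    case base
    show ?case by (rule exI[of _ "\<lambda>_. 0"]) simp
  next
    case (step c b y)
    then obtain a where a: "y = of_real (a 0) + (\<Sum>k\<in>gens TYPE('n). a k *\<^sub>R gen k)" by auto
    consider "b = 1" | j where "j \<in> gens TYPE('n)" "b = gen j" using step.hyps by auto
    then show ?case
    proof cases
      case 1
      have "(\<Sum>k\<in>gens TYPE('n). (a(0 := a 0 + c)) k *\<^sub>R gen k) =
          (\<Sum>k\<in>gens TYPE('n). a k *\<^sub>R (gen k :: 'n cclifford))"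
        by (intro sum.cong) auto
      then have "c *\<^sub>R b + y = of_real ((a(0 := a 0 + c)) 0) +
          (\<Sum>k\<in>gens TYPE('n). (a(0 := a 0 + c)) k *\<^sub>R gen k)"
        using 1 a by (simp add: of_real_def scaleR_add_left)
      then show ?thesis by blast
    next
      case (2 j)
      define a' where "a' = a(j := a j + c)"
      have "(\<Sum>k\<in>gens TYPE('n). a' k *\<^sub>R gen k) =
          (\<Sum>k\<in>gens TYPE('n). a k *\<^sub>R gen k + (if k = j then c *\<^sub>R gen j else 0 :: 'n cclifford))"
        by (intro sum.cong) (auto simp: a'_def scaleR_add_left)
      also have "\<dots> = (\<Sum>k\<in>gens TYPE('n). a k *\<^sub>R gen k) + c *\<^sub>R gen j"
        using 2(1) by (simp add: sum.distrib)
      finally have "c *\<^sub>R b + y = of_real (a' 0) + (\<Sum>k\<in>gens TYPE('n). a' k *\<^sub>R gen k)"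
        using 2 a by (simp add: a'_def)
      then show ?thesis by blast
    qed
  qed
  with that show ?thesis by blast
qed

lemma coeff_paravector:
  fixes a :: "nat \<Rightarrow> real"
  defines "\<kappa> \<equiv> of_real (a 0) + (\<Sum>k\<in>gens TYPE('n::len0). a k *\<^sub>R (gen k :: 'n cclifford))"
  shows "coeff \<kappa> {} = of_real (a 0)"
    and "k \<in> gens TYPE('n) \<Longrightarrow> coeff \<kappa> {k} = of_real (a k)"
    and "J \<noteq> {} \<Longrightarrow> (\<And>k. k \<in> gens TYPE('n) \<Longrightarrow> J \<noteq> {k}) \<Longrightarrow> coeff \<kappa> J = 0"
proof -
  show "coeff \<kappa> {} = of_real (a 0)"
    by (simp add: \<kappa>_def coeff_sum coeff_blade of_real_def)
  assume k: "k \<in> gens TYPE('n)"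
  have "coeff \<kappa> {k} = (\<Sum>l\<in>gens TYPE('n). if l = k then of_real (a k) else 0)"
  proof -
    have "coeff \<kappa> {k} = (\<Sum>l\<in>gens TYPE('n). coeff (a l *\<^sub>R (gen l :: 'n cclifford)) {k})"
      by (simp add: \<kappa>_def coeff_sum of_real_def)
    also have "\<dots> = (\<Sum>l\<in>gens TYPE('n). if l = k then of_real (a k) else 0)"
      by (intro sum.cong refl) (auto simp: coeff_blade complex_eq_iff)
    finally show ?thesis .
  qed
  with k show "coeff \<kappa> {k} = of_real (a k)" by simp
next
  assume "J \<noteq> {}" "\<And>k. k \<in> gens TYPE('n) \<Longrightarrow> J \<noteq> {k}"
  then show "coeff \<kappa> J = 0"
    by (auto simp: \<kappa>_def coeff_sum of_real_def coeff_blade intro!: sum.neutral)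
qed

lemma paravector_eq:
  "(\<kappa> :: 'n::len0 cclifford) \<in> paravectors \<Longrightarrow> \<kappa> = of_real (re_part \<kappa>) + im_part \<kappa>"
proof -
  assume "\<kappa> \<in> paravectors"
  then obtain a where a: "\<kappa> = of_real (a 0) + (\<Sum>k\<in>gens TYPE('n). a k *\<^sub>R gen k)"
    by (rule paravectorE)
  have "re_part \<kappa> = a 0"
    unfolding re_part_def a coeff_paravector by simp
  moreover have "im_part \<kappa> = (\<Sum>k\<in>gens TYPE('n). a k *\<^sub>R gen k)"
    unfolding im_part_def
  proof (intro sum.cong refl)
    fix k assume "k \<in> gens TYPE('n)"
    then have "coeff \<kappa> {k} = of_real (a k)" unfolding a by (rule coeff_paravector)
    then show "Re (coeff \<kappa> {k}) *\<^sub>R (gen k :: 'n cclifford) = a k *\<^sub>R gen k" by simp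
  qed
  ultimately show ?thesis using a by simp
qed

lemma norm_paravector:
  fixes a :: "nat \<Rightarrow> real"
  shows "norm (of_real (a 0) + (\<Sum>k\<in>gens TYPE('n::len0). a k *\<^sub>R (gen k :: 'n cclifford)))
    = sqrt (\<Sum>k=0..LENGTH('n). (a k)\<^sup>2)"
proof -
  let ?\<kappa> = "of_real (a 0) + (\<Sum>k\<in>gens TYPE('n::len0). a k *\<^sub>R (gen k :: 'n cclifford))"
  define S where "S = insert {} ((\<lambda>k. {k}) ` gens TYPE('n))"
  have "(\<Sum>J\<in>Pow (gens TYPE('n)). (cmod (coeff ?\<kappa> J))\<^sup>2) = (\<Sum>J\<in>S. (cmod (coeff ?\<kappa> J))\<^sup>2)"
  proof (rule sum.mono_neutral_right)
    have "coeff ?\<kappa> J = 0" if "J \<in> Pow (gens TYPE('n)) - S" for J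
      by (rule coeff_paravector(3)) (use that in \<open>auto simp: S_def\<close>)
    then show "\<forall>J\<in>Pow (gens TYPE('n)) - S. (cmod (coeff ?\<kappa> J))\<^sup>2 = 0" by simp
  qed (auto simp: S_def)
  also have "\<dots> = (a 0)\<^sup>2 + (\<Sum>k\<in>gens TYPE('n). (cmod (coeff ?\<kappa> {k}))\<^sup>2)"
    unfolding S_def
    by (subst sum.insert, simp, blast, subst coeff_paravector(1))
      (simp add: sum.reindex inj_on_def o_def del: coeff_simps)
  also have "\<dots> = (a 0)\<^sup>2 + (\<Sum>k\<in>gens TYPE('n). (a k)\<^sup>2)"
    by (intro arg_cong2[of _ _ _ _ "(+)"] refl sum.cong) (subst coeff_paravector(2), auto)
  also have "\<dots> = (\<Sum>k=0..LENGTH('n). (a k)\<^sup>2)"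
    by (simp add: sum.atLeast_Suc_atMost)
  finally show ?thesis by (simp add: norm_cclifford_def L2_set_def)
qed

lemma norm_im_part: "(norm (im_part (\<kappa> :: 'n::len0 cclifford)))\<^sup>2 =
    (\<Sum>k\<in>gens TYPE('n). (Re (coeff \<kappa> {k}))\<^sup>2)"
proof -
  define a where "a = (\<lambda>k. if k = 0 then 0 else Re (coeff \<kappa> {k}))"
  have im: "im_part \<kappa> = of_real (a 0) + (\<Sum>k\<in>gens TYPE('n). a k *\<^sub>R gen k)"
    by (simp add: im_part_def a_def)
  have "norm (im_part \<kappa>) = sqrt (\<Sum>k=0..LENGTH('n). (a k)\<^sup>2)"
    unfolding im by (rule norm_paravector)
  also have "(\<Sum>k=0..LENGTH('n). (a k)\<^sup>2) = (\<Sum>k\<in>gens TYPE('n). (Re (coeff \<kappa> {k}))\<^sup>2)"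
    by (simp add: sum.atLeast_Suc_atMost a_def)
  finally show ?thesis by (simp add: sum_nonneg)
qed

lemma im_part_square:
  "im_part (\<kappa> :: 'n::len0 cclifford) * im_part \<kappa> = - of_real ((norm (im_part \<kappa>))\<^sup>2)"
proof -
  define a where "a = (\<lambda>k. Re (coeff \<kappa> {k}))"
  let ?G = "gens TYPE('n)"
  have im: "im_part \<kappa> = (\<Sum>k\<in>?G. a k *\<^sub>R gen k)"
    by (simp add: im_part_def a_def)
  have 1: "im_part \<kappa> * im_part \<kappa> = (\<Sum>j\<in>?G. \<Sum>k\<in>?G. (a j * a k) *\<^sub>R (gen j * gen k))"
    unfolding im sum_product by (intro sum.cong refl) (simp add: mult.commute)
  also have "\<dots> = (\<Sum>j\<in>?G. \<Sum>k\<in>?G. (a j * a k) *\<^sub>R (gen k * gen j))"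
    by (subst sum.swap) (simp add: mult.commute)
  finally have "im_part \<kappa> * im_part \<kappa> + im_part \<kappa> * im_part \<kappa> =
      (\<Sum>j\<in>?G. \<Sum>k\<in>?G. (a j * a k) *\<^sub>R (gen j * gen k + gen k * gen j))"
    using 1 by (simp add: scaleR_add_right sum.distrib)
  also have "\<dots> = (\<Sum>j\<in>?G. \<Sum>k\<in>?G. if j = k then of_real (- 2 * (a j)\<^sup>2) else 0)"
  proof (intro sum.cong refl)
    fix j k assume "j \<in> ?G" "k \<in> ?G"
    then show "(a j * a k) *\<^sub>R (gen j * gen k + gen k * gen j) =
        (if j = k then of_real (- 2 * (a j)\<^sup>2) else (0 :: 'n cclifford))"
      using gen_square[where 'n='n, of j] gen_anticommute[where 'n='n, of j k]
      by (cases "j = k") (simp_all add: of_real_def power2_eq_square flip: scaleR_2)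
  qed
  also have "\<dots> = (\<Sum>j\<in>?G. of_real (- 2 * (a j)\<^sup>2))"
    by (intro sum.cong refl) simp
  also have "\<dots> = of_real (- 2 * (norm (im_part \<kappa>))\<^sup>2)"
    unfolding norm_im_part by (simp add: a_def sum_distrib_left sum_negf)
  finally have "2 *\<^sub>R (im_part \<kappa> * im_part \<kappa>) = 2 *\<^sub>R (- of_real ((norm (im_part \<kappa>))\<^sup>2))"
    by (simp add: of_real_def scaleR_2)
  then show ?thesis by (subst (asm) scaleR_cancel_left) simp
qed

lemma coeff_im_part_empty: "coeff (im_part \<kappa>) {} = 0"
  by (simp add: im_part_def coeff_sum coeff_blade)

lemma spectrum_eq_nonunits:
  assumes "(\<kappa> :: 'n::len0 cclifford) \<in> paravectors"
  shows "spectrum \<kappa> = {\<zeta>. \<nexists>x. (of_cx \<zeta> - \<kappa>) * x = 1 \<and> x * (of_cx \<zeta> - \<kappa>) = 1}"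
proof -
  define v where "v = im_part \<kappa>"
  have main: "(\<exists>x. (of_cx \<zeta> - \<kappa>) * x = 1 \<and> x * (of_cx \<zeta> - \<kappa>) = 1) \<longleftrightarrow>
    (\<zeta> - of_real (re_part \<kappa>))\<^sup>2 + of_real ((norm v)\<^sup>2) \<noteq> 0" for \<zeta>
  proof -
    define z where "z = \<zeta> - of_real (re_part \<kappa>)"
    define d where "d = z\<^sup>2 + of_real ((norm v)\<^sup>2)"
    have "(of_cx \<zeta> :: 'n cclifford) = of_cx z + of_real (re_part \<kappa>)"
      by (simp add: z_def flip: of_cx_of_real of_cx_add)
    then have w: "of_cx \<zeta> - \<kappa> = of_cx z - v"
      using arg_cong[OF paravector_eq[OF assms], of "\<lambda>x. of_cx \<zeta> - x"]
      by (simp add: z_def v_def of_cx_of_real algebra_simps)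
    have "of_cx d = of_cx z * of_cx z - v * v"
      unfolding d_def v_def im_part_square of_cx_add of_cx_of_real power2_eq_square[of z] of_cx_mult
      by simp
    then have p1: "(of_cx z - v) * (of_cx z + v) = of_cx d"
      and p2: "(of_cx z + v) * (of_cx z - v) = of_cx d"
      using of_cx_central[of z v] by (simp_all only: ring_distribs) simp_all
    have "(\<exists>x. (of_cx z - v) * x = 1 \<and> x * (of_cx z - v) = 1) \<longleftrightarrow> d \<noteq> 0"
    proof
      assume "\<exists>x. (of_cx z - v) * x = 1 \<and> x * (of_cx z - v) = 1"
      then obtain x where x: "(of_cx z - v) * x = 1" "x * (of_cx z - v) = 1" by auto
      show "d \<noteq> 0"
      proof
        assume "d = 0"
        have "of_cx 0 = (0 :: 'n cclifford)"
          by (rule cclifford_eqI) (simp add: coeff_of_cx)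
        then have "(of_cx z - v) * (of_cx z + v) = 0" using p1 \<open>d = 0\<close> by simp
        then have "x * (of_cx z - v) * (of_cx z + v) = 0" by (simp add: mult.assoc)
        then have zv: "of_cx z + v = 0" using x by simp
        then have "coeff (of_cx z + v) {} = 0" by simp
        then have "z = 0" by (simp add: coeff_of_cx v_def coeff_im_part_empty)
        with \<open>of_cx 0 = 0\<close> zv have "of_cx z - v = 0" by simp
        with x show False by simp
      qed
    next
      assume d: "d \<noteq> 0"
      have "of_cx (inverse d) * of_cx d = (1 :: 'n cclifford)"
        using d by (simp flip: of_cx_mult)
      then have "(of_cx z - v) * ((of_cx z + v) * of_cx (inverse d)) = 1"
        "((of_cx z + v) * of_cx (inverse d)) * (of_cx z - v) = 1"
        by (metis p1 mult.assoc of_cx_central) (metis p2 \<open>of_cx (inverse d) * of_cx d = 1\<close> mult.assoc of_cx_central)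
      then show "\<exists>x. (of_cx z - v) * x = 1 \<and> x * (of_cx z - v) = 1" by blast
    qed
    then show ?thesis by (simp add: w d_def z_def)
  qed
  have "(\<zeta> - of_real (re_part \<kappa>))\<^sup>2 + of_real ((norm v)\<^sup>2) =
      (\<zeta> - s_plus \<kappa>) * (\<zeta> - s_minus \<kappa>)" for \<zeta>
    by (simp add: complex_eq_iff s_plus_def s_minus_def v_def power2_eq_square algebra_simps)
  then show ?thesis by (auto simp: main spectrum_def)
qed


section \<open>Stem functions and their Clifford-valued images\<close>

text \<open>
  Functions on a set are represented by elements of \<^const>\<open>extensional\<close>.

  Analyticity is taken coordinatewise with respect to the basis \<open>e\<^sub>J\<close>. Each coordinate is
  required to agree on \<open>U\<close> with a function that is analytic at the points of \<open>U\<close>. On an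
  open set \<open>U\<close> this is holomorphy; for \<open>n = 0\<close>, where \<open>U\<close> is a subset of the
  real line, it is real analyticity (with complex coordinates).
\<close>

definition analytic_clifford :: "(complex \<Rightarrow> 'n::len0 cclifford) \<Rightarrow> complex set \<Rightarrow> bool" where
  "analytic_clifford F U \<longleftrightarrow>
     (\<forall>J \<subseteq> gens TYPE('n). \<exists>g. g analytic_on U \<and> (\<forall>\<zeta>\<in>U. coeff (F \<zeta>) J = g \<zeta>))"

lemma analytic_clifford_open:
  "open U \<Longrightarrow> analytic_clifford (F :: complex \<Rightarrow> 'n::len0 cclifford) U \<longleftrightarrow>
     (\<forall>J \<subseteq> gens TYPE('n). (\<lambda>\<zeta>. coeff (F \<zeta>) J) holomorphic_on U)"
  unfolding analytic_clifford_def
  by (metis analytic_on_open holomorphic_transform)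

definition stem :: "complex set \<Rightarrow> (complex \<Rightarrow> 'n::len0 cclifford) set" where
  "stem U = {F \<in> extensional U. analytic_clifford F U \<and> (\<forall>\<zeta>\<in>U. F (cnj \<zeta>) = cconj (F \<zeta>))}"

definition scalar_stem :: "complex set \<Rightarrow> (complex \<Rightarrow> 'n::len0 cclifford) set" where
  "scalar_stem U = {F \<in> stem U. \<forall>\<zeta>\<in>U. F \<zeta> \<in> range of_cx}"

lemma polynomial_stem:
  assumes "\<And>k. k \<le> m \<Longrightarrow> a k \<in> clifford_real"
  shows "(\<lambda>\<zeta>. \<Sum>k\<le>m. a k * of_cx \<zeta> ^ k) \<in> stem UNIV"
proof -
  have pow: "of_cx \<zeta> ^ k = of_cx (\<zeta> ^ k)" for \<zeta> and k :: nat
    by (induction k) (simp_all add: of_cx_mult)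
  have c: "coeff (\<Sum>k\<le>m. a k * of_cx \<zeta> ^ k) J = (\<Sum>k\<le>m. coeff (a k) J * \<zeta> ^ k)" for \<zeta> J
    unfolding coeff_sum pow
    by (intro sum.cong refl) (subst coeff_scalar_times_right, simp_all add: coeff_of_cx)
  have real: "cnj (coeff (a k) J) = coeff (a k) J" if "k \<le> m" for k J
    using assms[OF that] by (auto simp: clifford_real_iff Reals_cnj_iff)
  have "(\<lambda>\<zeta>. \<Sum>k\<le>m. coeff (a k) J * \<zeta> ^ k) analytic_on UNIV" for J
    by (intro analytic_intros)
  then show ?thesis
    unfolding stem_def analytic_clifford_def
    by (auto simp: c coeff_cconj real intro!: cclifford_eqI sum.cong)
qed

definition im_unit :: "'n::len0 cclifford \<Rightarrow> 'n cclifford" where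
  "im_unit \<kappa> = im_part \<kappa> /\<^sub>R norm (im_part \<kappa>)"

definition sigma_ext ::
    "'n::len0 cclifford set \<Rightarrow> (complex \<Rightarrow> 'n cclifford) \<Rightarrow> 'n cclifford \<Rightarrow> 'n cclifford" where
  "sigma_ext \<Omega> F = (\<lambda>\<kappa>\<in>\<Omega>.
     if \<kappa> \<in> \<real> then F (of_real (re_part \<kappa>))
     else F (s_plus \<kappa>) * ((1 - of_cx \<i> * im_unit \<kappa>) /\<^sub>R 2)
        + F (s_minus \<kappa>) * ((1 + of_cx \<i> * im_unit \<kappa>) /\<^sub>R 2))"

definition slice_regular :: "'n::len0 cclifford set \<Rightarrow> ('n cclifford \<Rightarrow> 'n cclifford) set" where
  "slice_regular \<Omega> = sigma_ext \<Omega> ` stem (spectra \<Omega>)"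

definition intrinsic_regular :: "'n::len0 cclifford set \<Rightarrow> ('n cclifford \<Rightarrow> 'n cclifford) set" where
  "intrinsic_regular \<Omega> = sigma_ext \<Omega> ` scalar_stem (spectra \<Omega>)"


section \<open>Pointwise algebraic structures on sets of functions\<close>

text \<open>
  \<open>fun_algebra D S\<close> carries the pointwise real-linear and multiplicative structure on
  \<open>S\<close>, and \<open>fun_right_module D S\<close> the right action of functions,
  \<open>f \<odot> F\<close> being the pointwise product \<open>F f\<close>. The components \<open>mult\<close> and \<open>one\<close>
  of a record serving only as a module are irrelevant, as in \<^locale>\<open>Module.module\<close>.
\<close>

definition fun_algebra ::
    "'x set \<Rightarrow> ('x \<Rightarrow> 'b::real_algebra_1) set \<Rightarrow> (real, 'x \<Rightarrow> 'b) module" where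
  "fun_algebra D S =
     \<lparr>carrier = S, monoid.mult = (\<lambda>f g. \<lambda>x\<in>D. f x * g x), one = (\<lambda>x\<in>D. 1),
      zero = (\<lambda>x\<in>D. 0), add = (\<lambda>f g. \<lambda>x\<in>D. f x + g x),
      module.smult = (\<lambda>r f. \<lambda>x\<in>D. r *\<^sub>R f x)\<rparr>"

definition fun_right_module ::
    "'x set \<Rightarrow> ('x \<Rightarrow> 'b::real_algebra_1) set \<Rightarrow> ('x \<Rightarrow> 'b, 'x \<Rightarrow> 'b) module" where
  "fun_right_module D S =
     \<lparr>carrier = S, monoid.mult = (\<lambda>f g. \<lambda>x\<in>D. f x * g x), one = (\<lambda>x\<in>D. 1),
      zero = (\<lambda>x\<in>D. 0), add = (\<lambda>f g. \<lambda>x\<in>D. f x + g x),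
      module.smult = (\<lambda>f F. \<lambda>x\<in>D. F x * f x)\<rparr>"

text \<open>A right module: \<open>a \<odot> x\<close> stands for \<open>x a\<close>, whence the order in \<open>smult_assoc\<close>.\<close>

locale right_module = R?: ring R + M?: abelian_group M
  for R :: "('a, 'c) ring_scheme" (structure) and M :: "('a, 'b, 'd) module_scheme" (structure) +
  assumes smult_closed:
      "\<lbrakk>a \<in> carrier R; x \<in> carrier M\<rbrakk> \<Longrightarrow> a \<odot>\<^bsub>M\<^esub> x \<in> carrier M"
    and smult_distr_scalar:
      "\<lbrakk>a \<in> carrier R; b \<in> carrier R; x \<in> carrier M\<rbrakk> \<Longrightarrow>
       (a \<oplus>\<^bsub>R\<^esub> b) \<odot>\<^bsub>M\<^esub> x = a \<odot>\<^bsub>M\<^esub> x \<oplus>\<^bsub>M\<^esub> b \<odot>\<^bsub>M\<^esub> x"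
    and smult_distr_vector:
      "\<lbrakk>a \<in> carrier R; x \<in> carrier M; y \<in> carrier M\<rbrakk> \<Longrightarrow>
       a \<odot>\<^bsub>M\<^esub> (x \<oplus>\<^bsub>M\<^esub> y) = a \<odot>\<^bsub>M\<^esub> x \<oplus>\<^bsub>M\<^esub> a \<odot>\<^bsub>M\<^esub> y"
    and smult_assoc:
      "\<lbrakk>a \<in> carrier R; b \<in> carrier R; x \<in> carrier M\<rbrakk> \<Longrightarrow>
       (a \<otimes>\<^bsub>R\<^esub> b) \<odot>\<^bsub>M\<^esub> x = b \<odot>\<^bsub>M\<^esub> (a \<odot>\<^bsub>M\<^esub> x)"
    and smult_one: "x \<in> carrier M \<Longrightarrow> \<one>\<^bsub>R\<^esub> \<odot>\<^bsub>M\<^esub> x = x"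

definition linear_iso ::
    "(real, 'b, 'c) module_scheme \<Rightarrow> (real, 'd, 'e) module_scheme \<Rightarrow> ('b \<Rightarrow> 'd) set" where
  "linear_iso M N = {h. bij_betw h (carrier M) (carrier N) \<and>
     (\<forall>x\<in>carrier M. \<forall>y\<in>carrier M. h (x \<oplus>\<^bsub>M\<^esub> y) = h x \<oplus>\<^bsub>N\<^esub> h y) \<and>
     (\<forall>r. \<forall>x\<in>carrier M. h (r \<odot>\<^bsub>M\<^esub> x) = r \<odot>\<^bsub>N\<^esub> h x)}"

definition real_ring :: "real ring" where
  "real_ring = \<lparr>carrier = UNIV, monoid.mult = (*), one = 1, zero = 0, add = (+)\<rparr>"

end

theory Submission
  imports Defs
begin

text \<open>
  For a nonreal paravector \<open>\<kappa>\<close> the elements \<open>p = (1 - i s)/2\<close> and \<open>1 - p\<close> are complementary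
  idempotents satisfying \<open>\<kappa>p = s\<^sub>+(\<kappa>)p\<close> and \<open>\<kappa>(1 - p) = s\<^sub>-(\<kappa>)(1 - p)\<close>, and
  \<open>F\<^sub>\<sigma>(\<kappa>) = F(s\<^sub>+(\<kappa>))p + F(s\<^sub>-(\<kappa>))(1 - p)\<close>. Scalar values commute with \<open>p\<close>, so this spectral
  decomposition makes \<open>F \<mapsto> F\<^sub>\<sigma>\<close> multiplicative and evaluates polynomials at \<open>\<kappa>\<close>. The
  reflection \<open>\<kappa> \<mapsto> 2\<Re>(\<kappa>) - \<kappa>\<close> preserves the spectrum and exchanges \<open>p\<close> and \<open>1 - p\<close>; hence
  \<open>F\<^sub>\<sigma>\<close> determines \<open>F\<close> on the spectra.
\<close>

section \<open>Pointwise structures\<close>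

text \<open>Common interface for stem functions on \<open>U\<close> and their images on
  \<open>\<Omega>\<close>, so that the algebraic laws are checked once for both.\<close>

locale pointwise_space =
  fixes D :: "'x set" and S :: "('x \<Rightarrow> 'b::real_algebra_1) set"
  assumes extensional: "S \<subseteq> extensional D"
    and zero_closed: "(\<lambda>x\<in>D. 0) \<in> S"
    and add_closed: "f \<in> S \<Longrightarrow> g \<in> S \<Longrightarrow> (\<lambda>x\<in>D. f x + g x) \<in> S"
    and scaleR_closed: "f \<in> S \<Longrightarrow> (\<lambda>x\<in>D. r *\<^sub>R f x) \<in> S"
begin

lemma restrict_self: "f \<in> S \<Longrightarrow> (\<lambda>x\<in>D. f x) = f"
  using extensional by (auto simp: extensional_restrict)

lemma uminus_closed: "f \<in> S \<Longrightarrow> (\<lambda>x\<in>D. - f x) \<in> S"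
  using scaleR_closed[of f "-1"] by simp

text \<open>Fixing just these three record components lets one proof serve
  \<open>fun_algebra\<close> and \<open>fun_right_module\<close>, whose scalar types differ.\<close>

lemma abelian_group_pointwise:
  assumes "carrier M = S" "\<zero>\<^bsub>M\<^esub> = (\<lambda>x\<in>D. 0)" "add M = (\<lambda>f g. \<lambda>x\<in>D. f x + g x)"
  shows "abelian_group M"
proof (rule abelian_groupI)
  fix f assume "f \<in> carrier M"
  then have "(\<lambda>x\<in>D. - f x) \<in> carrier M" by (simp add: assms uminus_closed)
  moreover have "(\<lambda>x\<in>D. - f x) \<oplus>\<^bsub>M\<^esub> f = \<zero>\<^bsub>M\<^esub>" by (auto simp: assms)
  ultimately show "\<exists>g\<in>carrier M. g \<oplus>\<^bsub>M\<^esub> f = \<zero>\<^bsub>M\<^esub>" by blast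
qed (auto simp: assms zero_closed add_closed restrict_self algebra_simps cong: restrict_cong)

lemma abelian_group_fun_algebra: "abelian_group (fun_algebra D S)"
  and abelian_group_fun_right_module: "abelian_group (fun_right_module D S)"
  by (rule abelian_group_pointwise; simp add: fun_algebra_def fun_right_module_def)+

text \<open>Transports closure along a real-linear map; this is how the spaces of regular functions
  inherit their structure from stem functions.\<close>

lemma pointwise_space_image:
  fixes h :: "('x \<Rightarrow> 'b) \<Rightarrow> 'y \<Rightarrow> 'c::real_algebra_1"
  assumes "h ` S \<subseteq> extensional E"
    and add: "\<And>f g. f \<in> S \<Longrightarrow> g \<in> S \<Longrightarrow> h (\<lambda>x\<in>D. f x + g x) = (\<lambda>y\<in>E. h f y + h g y)"
    and scaleR: "\<And>f r. f \<in> S \<Longrightarrow> h (\<lambda>x\<in>D. r *\<^sub>R f x) = (\<lambda>y\<in>E. r *\<^sub>R h f y)"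
  shows "pointwise_space E (h ` S)"
proof
  show "(\<lambda>y\<in>E. 0) \<in> h ` S"
    \<comment> \<open>Compatibility of \<open>h\<close> with scaling by 0 shows that it sends the
      zero function to the zero function.\<close>
    using imageI[OF zero_closed, of h] scaleR[OF zero_closed, of 0] by (simp cong: restrict_cong)
  show "(\<lambda>y\<in>E. u y + v y) \<in> h ` S" if "u \<in> h ` S" "v \<in> h ` S" for u v
    using that add_closed by (auto simp flip: add)
  show "(\<lambda>y\<in>E. r *\<^sub>R u y) \<in> h ` S" if "u \<in> h ` S" for r u
    using that scaleR_closed by (auto simp flip: scaleR)
qed fact

end

locale pointwise_algebra = pointwise_space +
  assumes one_closed: "(\<lambda>x\<in>D. 1) \<in> S"
    and mult_closed: "f \<in> S \<Longrightarrow> g \<in> S \<Longrightarrow> (\<lambda>x\<in>D. f x * g x) \<in> S"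
begin

lemma ring_fun_algebra: "ring (fun_algebra D S)"
proof (rule ringI[OF abelian_group_fun_algebra])
  show "Group.monoid (fun_algebra D S)"
    by (rule monoidI)
      (auto simp: fun_algebra_def one_closed mult_closed restrict_self mult.assoc cong: restrict_cong)
qed (auto simp: fun_algebra_def algebra_simps cong: restrict_cong)

lemma right_module_fun:
  assumes "pointwise_space D M"
    and "\<And>F f. F \<in> M \<Longrightarrow> f \<in> S \<Longrightarrow> (\<lambda>x\<in>D. F x * f x) \<in> M"
  shows "right_module (fun_algebra D S) (fun_right_module D M)"
proof -
  interpret M: pointwise_space D M by fact
  show ?thesis
  proof (intro right_module.intro right_module_axioms.intro ring_fun_algebra
      M.abelian_group_fun_right_module)
  qed (auto simp: fun_algebra_def fun_right_module_def assms(2) M.restrict_self algebra_simps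
      cong: restrict_cong)
qed

end

lemma cring_real_ring: "cring real_ring"
proof (rule cringI)
  show "abelian_group real_ring"
    by (rule abelian_groupI) (auto simp: real_ring_def intro: exI[of _ "- x" for x])
  show "Group.comm_monoid real_ring"
    by (rule comm_monoidI) (auto simp: real_ring_def)
qed (auto simp: real_ring_def algebra_simps)

text \<open>The ambient algebra \<open>'b\<close> may be noncommutative, so commutation is asked of
  the values of members of \<open>S\<close> alone.\<close>

lemma (in pointwise_algebra) algebra_fun_algebra:
  assumes "\<And>f g x. f \<in> S \<Longrightarrow> g \<in> S \<Longrightarrow> x \<in> D \<Longrightarrow> f x * g x = g x * f x"
  shows "Module.algebra real_ring (fun_algebra D S)"
proof (rule algebraI[OF cring_real_ring])
  interpret ring "fun_algebra D S" by (rule ring_fun_algebra)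
  have "Group.comm_monoid (fun_algebra D S)"
    by (rule monoid_comm_monoidI) (auto simp: fun_algebra_def assms cong: restrict_cong)
  then show "cring (fun_algebra D S)" by (intro cring.intro ring_fun_algebra)
qed (auto simp: fun_algebra_def real_ring_def scaleR_closed restrict_self algebra_simps
    cong: restrict_cong)


section \<open>Complex conjugation and the real Clifford algebra\<close>

lemma blade_sgn_real: "blade_sgn J K \<in> \<real>"
  by (simp add: blade_sgn_def)

lemma cconj_simps:
  "cconj 0 = 0"
  "cconj 1 = 1"
  "cconj (x + y) = cconj x + cconj y"
  "cconj (r *\<^sub>R x) = r *\<^sub>R cconj x"
  by (rule cclifford_eqI; simp add: coeff_cconj)+

text \<open>The structure constants \<open>blade_sgn\<close> are real, so conjugating coefficients
  respects products.\<close>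

lemma cconj_mult: "cconj (x * y) = cconj x * cconj y"
proof (rule cclifford_eqI)
  have "cnj (blade_sgn J K) = blade_sgn J K" for J K
    using blade_sgn_real Reals_cnj_iff by blast
  then show "coeff (cconj (x * y)) L = coeff (cconj x * cconj y) L" for L
    by (auto simp: coeff_cconj coeff_times if_distrib[of cnj] intro!: sum.cong)
qed

text \<open>As the fixed set of a multiplicative map, the real Clifford algebra is visibly closed
  under products and powers.\<close>

lemma clifford_real_cconj: "x \<in> clifford_real \<longleftrightarrow> cconj x = x"
  by (metis clifford_real_iff Reals_cnj_iff coeff_cconj cclifford_eqI)

lemma clifford_real_mult:
  assumes "x \<in> clifford_real" "y \<in> clifford_real"
  shows "x * y \<in> clifford_real"
  using assms by (simp add: clifford_real_cconj cconj_mult)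

lemma clifford_real_power: "x \<in> clifford_real \<Longrightarrow> x ^ k \<in> clifford_real"
  by (induction k) (simp_all add: clifford_real_mult clifford_real_cconj[of 1] cconj_simps)

lemma paravectors_subset_clifford_real: "paravectors \<subseteq> clifford_real"
  unfolding paravectors_def clifford_real_def
  by (intro span_mono) (auto simp flip: blade_empty)

lemma of_cx_scaleR: "of_cx (r *\<^sub>R c) = r *\<^sub>R of_cx c"
  by (rule cclifford_eqI) (simp add: coeff_of_cx)


section \<open>The spectral idempotents\<close>

lemma s_minus_eq_cnj: "s_minus \<kappa> = cnj (s_plus \<kappa>)"
  by (simp add: s_plus_def s_minus_def complex_eq_iff)

lemma spectra_cnj: "\<zeta> \<in> spectra \<Omega> \<Longrightarrow> cnj \<zeta> \<in> spectra \<Omega>"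
  by (auto simp: spectra_def spectrum_def s_minus_eq_cnj)

lemma s_plus_in_spectra: "\<kappa> \<in> \<Omega> \<Longrightarrow> s_plus \<kappa> \<in> spectra \<Omega>"
  and s_minus_in_spectra: "\<kappa> \<in> \<Omega> \<Longrightarrow> s_minus \<kappa> \<in> spectra \<Omega>"
  by (auto simp: spectra_def spectrum_def)

text \<open>Links the case split in \<open>sigma_ext\<close> to the condition under which
  \<open>im_unit\<close> squares to -1.\<close>

lemma paravector_real_iff:
  assumes "\<kappa> \<in> paravectors"
  shows "\<kappa> \<in> \<real> \<longleftrightarrow> im_part \<kappa> = 0"
proof
  show "\<kappa> \<in> \<real> \<Longrightarrow> im_part \<kappa> = 0"
    by (auto simp: Reals_def im_part_def coeff_of_real)
  show "im_part \<kappa> = 0 \<Longrightarrow> \<kappa> \<in> \<real>"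
    using paravector_eq[OF assms] by (metis Reals_of_real add.right_neutral)
qed

text \<open>At real \<open>\<kappa>\<close> this is \<open>1/2\<close>, since then \<open>im_unit \<kappa> = 0\<close>.\<close>

definition spec_proj :: "'n::len0 cclifford \<Rightarrow> 'n cclifford" where
  "spec_proj \<kappa> = (1 - of_cx \<i> * im_unit \<kappa>) /\<^sub>R 2"

lemma one_minus_spec_proj: "1 - spec_proj \<kappa> = (1 + of_cx \<i> * im_unit \<kappa>) /\<^sub>R 2"
proof -
  have "1 = (1 / 2) *\<^sub>R (1 :: 'a cclifford) + (1 / 2) *\<^sub>R 1"
    by (simp flip: scaleR_add_left)
  then show ?thesis by (simp add: spec_proj_def algebra_simps)
qed

lemma im_unit_square:
  assumes "im_part \<kappa> \<noteq> 0"
  shows "im_unit \<kappa> * im_unit \<kappa> = - 1"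
  using assms by (simp add: im_unit_def im_part_square of_real_def power2_eq_square field_simps)

lemma of_cx_i_square: "of_cx \<i> * of_cx \<i> = - 1"
  by (simp flip: of_cx_mult)

text \<open>Since \<open>of_cx \<i>\<close> is central,
  \<open>w = of_cx \<i> * im_unit \<kappa>\<close> satisfies \<open>w * w = (-1) * (-1) = 1\<close>,
  and then \<open>(1 - w) / 2\<close> is idempotent.\<close>

lemma spec_proj_idem:
  assumes "im_part \<kappa> \<noteq> 0"
  shows "spec_proj \<kappa> * spec_proj \<kappa> = spec_proj \<kappa>"
proof -
  define w where "w = of_cx \<i> * im_unit \<kappa>"
  have "w * w = of_cx \<i> * of_cx \<i> * (im_unit \<kappa> * im_unit \<kappa>)"
    unfolding w_def by (metis mult.assoc of_cx_central)
  then have "w * w = 1" by (simp add: of_cx_i_square im_unit_square assms)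
  then have "(1 - w) * (1 - w) = 2 *\<^sub>R (1 - w)" by (simp add: algebra_simps scaleR_2)
  then show ?thesis by (simp add: spec_proj_def flip: w_def)
qed

text \<open>One formula covers both branches of the definition: at a real point the two spectral
  values coincide, and the coefficients \<open>p\<close> and \<open>1 - p\<close> add up to
  1.\<close>

lemma sigma_ext_apply:
  assumes "\<kappa> \<in> \<Omega>" "\<kappa> \<in> paravectors"
  shows "sigma_ext \<Omega> F \<kappa> = F (s_plus \<kappa>) * spec_proj \<kappa> + F (s_minus \<kappa>) * (1 - spec_proj \<kappa>)"
proof (cases "\<kappa> \<in> \<real>")
  case True
  then have "im_part \<kappa> = 0" using assms by (simp add: paravector_real_iff)
  then have "s_plus \<kappa> = of_real (re_part \<kappa>)" "s_minus \<kappa> = of_real (re_part \<kappa>)"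
    by (simp_all add: s_plus_def s_minus_def complex_eq_iff)
  then show ?thesis using True assms by (simp add: sigma_ext_def flip: distrib_left)
next
  case False
  then show ?thesis using assms
    unfolding one_minus_spec_proj by (simp add: sigma_ext_def spec_proj_def)
qed

text \<open>Write \<open>\<kappa> = r + b s\<close>. From \<open>s * s = -1\<close> one gets
  \<open>s (1 - i s) = i (1 - i s)\<close> and \<open>s (1 + i s) = - i (1 + i s)\<close>, so
  \<open>\<kappa>\<close> acts on the two projections as \<open>r + i b\<close> and
  \<open>r - i b\<close>.\<close>

lemma paravector_mult_spec_proj:
  assumes "\<kappa> \<in> paravectors"
  shows "\<kappa> * spec_proj \<kappa> = of_cx (s_plus \<kappa>) * spec_proj \<kappa>"
    and "\<kappa> * (1 - spec_proj \<kappa>) = of_cx (s_minus \<kappa>) * (1 - spec_proj \<kappa>)"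
proof -
  define r b s where "r = re_part \<kappa>" and "b = norm (im_part \<kappa>)" and "s = im_unit \<kappa>"
  have "im_part \<kappa> = b *\<^sub>R s"
    by (cases "im_part \<kappa> = 0") (simp_all add: b_def s_def im_unit_def)
  then have \<kappa>: "\<kappa> = of_real r + b *\<^sub>R s"
    using paravector_eq[OF assms] by (simp add: r_def)
  have c: "of_cx (Complex r y) = (of_real r + y *\<^sub>R of_cx \<i> :: 'a cclifford)" for y
    by (rule cclifford_eqI) (simp add: coeff_of_cx coeff_of_real complex_eq_iff)
  have si: "s * (of_cx \<i> * s) = of_cx \<i> * (s * s)"
    by (metis mult.assoc of_cx_central)
  have ii: "of_cx \<i> * (of_cx \<i> * s) = - s"
    by (simp add: of_cx_i_square flip: mult.assoc)
  have ss: "s * s = - 1" if "b \<noteq> 0"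
    using that by (simp add: b_def s_def im_unit_square)
  \<comment> \<open>The factor \<open>b\<close> is kept because \<open>s = 0\<close> when
    \<open>b = 0\<close>; the identities then hold trivially.\<close>
  have eigen: "b *\<^sub>R (s * (1 - of_cx \<i> * s)) = b *\<^sub>R (of_cx \<i> * (1 - of_cx \<i> * s))"
    "b *\<^sub>R (s * (1 + of_cx \<i> * s)) = - b *\<^sub>R (of_cx \<i> * (1 + of_cx \<i> * s))"
    by (cases "b = 0"; simp add: right_diff_distrib distrib_left si ii ss algebra_simps)+
  have "\<kappa> * (1 - of_cx \<i> * s) = of_cx (s_plus \<kappa>) * (1 - of_cx \<i> * s)"
    using eigen(1) unfolding s_plus_def r_def[symmetric] b_def[symmetric] c
    by (subst \<kappa>) (simp only: distrib_right mult_scaleR_left)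
  then show "\<kappa> * spec_proj \<kappa> = of_cx (s_plus \<kappa>) * spec_proj \<kappa>"
    by (simp only: spec_proj_def mult_scaleR_right s_def)
  have "\<kappa> * (1 + of_cx \<i> * s) = of_cx (s_minus \<kappa>) * (1 + of_cx \<i> * s)"
    using eigen(2) unfolding s_minus_def r_def[symmetric] b_def[symmetric] c
    by (subst \<kappa>) (simp only: distrib_right mult_scaleR_left)
  then show "\<kappa> * (1 - spec_proj \<kappa>) = of_cx (s_minus \<kappa>) * (1 - spec_proj \<kappa>)"
    by (simp only: one_minus_spec_proj mult_scaleR_right s_def)
qed

section \<open>Polynomials evaluated at a paravector\<close>

lemma of_cx_power: "of_cx (c ^ k) = of_cx c ^ k"
  by (induction k) (simp_all add: of_cx_mult)

text \<open>Centrality of the eigenvalue lets it pass each further factor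
  \<open>\<kappa>\<close>.\<close>

lemma power_eigen:
  assumes "\<kappa> * p = of_cx c * p"
  shows "\<kappa> ^ k * p = of_cx c ^ k * p"
proof (induction k)
  case (Suc k)
  have "\<kappa> ^ Suc k * p = \<kappa> * (of_cx (c ^ k) * p)"
    by (simp add: Suc mult.assoc of_cx_power)
  also have "\<dots> = of_cx (c ^ k) * (\<kappa> * p)"
    by (simp only: of_cx_central[of _ \<kappa>] flip: mult.assoc)
  also have "\<dots> = of_cx c ^ Suc k * p"
    by (simp only: assms of_cx_power power_Suc2 mult.assoc)
  finally show ?case .
qed simp

text \<open>Each coefficient \<open>a k\<close> stays on the left while the eigenvalue relations act
  to its right, which matters because \<open>a k\<close> and \<open>\<kappa>\<close> need not
  commute.\<close>

lemma sigma_ext_polynomial: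
  assumes "\<kappa> \<in> paravectors"
  shows "sigma_ext paravectors (\<lambda>\<zeta>. \<Sum>k\<le>m. a k * of_cx \<zeta> ^ k) \<kappa> = (\<Sum>k\<le>m. a k * \<kappa> ^ k)"
proof -
  have "a k * of_cx (s_plus \<kappa>) ^ k * spec_proj \<kappa> + a k * of_cx (s_minus \<kappa>) ^ k * (1 - spec_proj \<kappa>)
      = a k * \<kappa> ^ k" for k
    \<comment> \<open>Eigenvalue powers are turned back into powers of \<open>\<kappa>\<close>; the
      two projections then add up to 1.\<close>
    unfolding mult.assoc paravector_mult_spec_proj[OF assms, THEN power_eigen, symmetric]
    by (simp flip: distrib_left)
  then show ?thesis
    by (simp add: sigma_ext_apply assms sum_distrib_right flip: sum.distrib)
qed


section \<open>The map from stem functions to slice regular functions\<close>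

lemma analytic_cliffordI:
  fixes F :: "complex \<Rightarrow> 'n::len0 cclifford"
  assumes "\<And>J. J \<subseteq> gens TYPE('n) \<Longrightarrow> g J analytic_on U"
    and "\<And>J \<zeta>. J \<subseteq> gens TYPE('n) \<Longrightarrow> \<zeta> \<in> U \<Longrightarrow> coeff (F \<zeta>) J = g J \<zeta>"
  shows "analytic_clifford F U"
  using assms unfolding analytic_clifford_def by blast

text \<open>Chooses analytic representatives of all coordinates at once, so that the values of
  \<open>F\<close> off \<open>U\<close> never enter an analyticity proof.\<close>

lemma analytic_cliffordE:
  fixes F :: "complex \<Rightarrow> 'n::len0 cclifford"
  assumes "analytic_clifford F U"
  obtains g where "\<And>J. J \<subseteq> gens TYPE('n) \<Longrightarrow> g J analytic_on U"
    and "\<And>J \<zeta>. J \<subseteq> gens TYPE('n) \<Longrightarrow> \<zeta> \<in> U \<Longrightarrow> coeff (F \<zeta>) J = g J \<zeta>"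
  using assms unfolding analytic_clifford_def by metis

lemma analytic_clifford_scaleR:
  fixes F :: "complex \<Rightarrow> 'n::len0 cclifford"
  assumes "analytic_clifford F U"
  shows "analytic_clifford (\<lambda>\<zeta>\<in>U. r *\<^sub>R F \<zeta>) U"
proof -
  obtain f where f: "\<And>J. J \<subseteq> gens TYPE('n) \<Longrightarrow> f J analytic_on U"
    "\<And>J \<zeta>. J \<subseteq> gens TYPE('n) \<Longrightarrow> \<zeta> \<in> U \<Longrightarrow> coeff (F \<zeta>) J = f J \<zeta>"
    using analytic_cliffordE[OF assms] by metis
  show ?thesis
    by (rule analytic_cliffordI[of "\<lambda>J \<zeta>. r *\<^sub>R f J \<zeta>"])
      (auto simp: f scaleR_conv_of_real[where 'a=complex] intro!: analytic_intros f)
qed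

lemma analytic_clifford_add:
  fixes F G :: "complex \<Rightarrow> 'n::len0 cclifford"
  assumes "analytic_clifford F U" "analytic_clifford G U"
  shows "analytic_clifford (\<lambda>\<zeta>\<in>U. F \<zeta> + G \<zeta>) U"
proof -
  obtain f where f: "\<And>J. J \<subseteq> gens TYPE('n) \<Longrightarrow> f J analytic_on U"
    "\<And>J \<zeta>. J \<subseteq> gens TYPE('n) \<Longrightarrow> \<zeta> \<in> U \<Longrightarrow> coeff (F \<zeta>) J = f J \<zeta>"
    using analytic_cliffordE[OF assms(1)] by metis
  obtain g where g: "\<And>J. J \<subseteq> gens TYPE('n) \<Longrightarrow> g J analytic_on U"
    "\<And>J \<zeta>. J \<subseteq> gens TYPE('n) \<Longrightarrow> \<zeta> \<in> U \<Longrightarrow> coeff (G \<zeta>) J = g J \<zeta>"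
    using analytic_cliffordE[OF assms(2)] by metis
  show ?thesis
    by (rule analytic_cliffordI[of "\<lambda>J \<zeta>. f J \<zeta> + g J \<zeta>"])
      (auto simp: f g intro!: analytic_intros f g)
qed

lemma analytic_clifford_mult:
  fixes F G :: "complex \<Rightarrow> 'n::len0 cclifford"
  assumes "analytic_clifford F U" "analytic_clifford G U"
  shows "analytic_clifford (\<lambda>\<zeta>\<in>U. F \<zeta> * G \<zeta>) U"
proof -
  obtain f where f: "\<And>J. J \<subseteq> gens TYPE('n) \<Longrightarrow> f J analytic_on U"
    "\<And>J \<zeta>. J \<subseteq> gens TYPE('n) \<Longrightarrow> \<zeta> \<in> U \<Longrightarrow> coeff (F \<zeta>) J = f J \<zeta>"
    using analytic_cliffordE[OF assms(1)] by metis
  obtain g where g: "\<And>J. J \<subseteq> gens TYPE('n) \<Longrightarrow> g J analytic_on U"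
    "\<And>J \<zeta>. J \<subseteq> gens TYPE('n) \<Longrightarrow> \<zeta> \<in> U \<Longrightarrow> coeff (G \<zeta>) J = g J \<zeta>"
    using analytic_cliffordE[OF assms(2)] by metis
  show ?thesis
  proof (rule analytic_cliffordI)
    fix L
    \<comment> \<open>The condition on \<open>J\<close> and \<open>K\<close> is moved into a factor
      constant in \<open>\<zeta>\<close>, leaving a finite sum of products of analytic
      functions.\<close>
    show "(\<lambda>\<zeta>. \<Sum>J\<in>Pow (gens TYPE('n)). \<Sum>K\<in>Pow (gens TYPE('n)).
        (if sym_diff J K = L then blade_sgn J K else 0) * f J \<zeta> * g K \<zeta>) analytic_on U"
      by (intro analytic_intros f g) auto
    show "coeff ((\<lambda>\<zeta>\<in>U. F \<zeta> * G \<zeta>) \<zeta>) L = (\<Sum>J\<in>Pow (gens TYPE('n)). \<Sum>K\<in>Pow (gens TYPE('n)).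
        (if sym_diff J K = L then blade_sgn J K else 0) * f J \<zeta> * g K \<zeta>)" if "\<zeta> \<in> U" for \<zeta>
      using that by (auto simp: coeff_times f g intro!: sum.cong)
  qed
qed

text \<open>Symmetry of \<open>U\<close> is what allows a restricted function to be evaluated at
  \<open>cnj \<zeta>\<close> in the stem condition; the rest is compatibility of
  \<open>cconj\<close> with the operations.\<close>

lemma pointwise_algebra_stem:
  fixes U :: "complex set"
  assumes cnj: "\<And>\<zeta>. \<zeta> \<in> U \<Longrightarrow> cnj \<zeta> \<in> U"
  shows "pointwise_algebra U (stem U :: (complex \<Rightarrow> 'n::len0 cclifford) set)"
proof
  show "(\<lambda>\<zeta>\<in>U. 0) \<in> (stem U :: (complex \<Rightarrow> 'n cclifford) set)"
    by (auto simp: stem_def cnj cconj_simps intro!: analytic_cliffordI[of "\<lambda>_ _. 0"])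
  show "(\<lambda>\<zeta>\<in>U. 1) \<in> (stem U :: (complex \<Rightarrow> 'n cclifford) set)"
  proof -
    have "analytic_clifford (\<lambda>\<zeta>\<in>U. 1 :: 'n cclifford) U"
      by (rule analytic_cliffordI[of "\<lambda>J _. if J = {} then 1 else 0"]) (rule analytic_on_const, simp)
    then show ?thesis by (simp add: stem_def cnj cconj_simps)
  qed
  fix F G :: "complex \<Rightarrow> 'n cclifford" assume F: "F \<in> stem U"
  show "(\<lambda>\<zeta>\<in>U. r *\<^sub>R F \<zeta>) \<in> stem U" for r
    using F by (auto simp: stem_def cnj cconj_simps analytic_clifford_scaleR)
  assume G: "G \<in> stem U"
  show "(\<lambda>\<zeta>\<in>U. F \<zeta> + G \<zeta>) \<in> stem U"
    using F G by (auto simp: stem_def cnj cconj_simps analytic_clifford_add)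
  show "(\<lambda>\<zeta>\<in>U. F \<zeta> * G \<zeta>) \<in> stem U"
    using F G by (auto simp: stem_def cnj cconj_mult analytic_clifford_mult)
qed (auto simp: stem_def)

lemma scalar_stem_subset: "scalar_stem U \<subseteq> stem U"
  by (auto simp: scalar_stem_def)

lemma pointwise_algebra_scalar_stem:
  fixes U :: "complex set"
  assumes "\<And>\<zeta>. \<zeta> \<in> U \<Longrightarrow> cnj \<zeta> \<in> U"
  shows "pointwise_algebra U (scalar_stem U :: (complex \<Rightarrow> 'n::len0 cclifford) set)"
proof -
  interpret pointwise_algebra U "stem U :: (complex \<Rightarrow> 'n cclifford) set"
    by (rule pointwise_algebra_stem) fact
  have range: "0 \<in> range (of_cx :: _ \<Rightarrow> 'n cclifford)" "1 \<in> range (of_cx :: _ \<Rightarrow> 'n cclifford)"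
    using of_cx_of_real[of 0] of_cx_one by (metis of_real_0 rangeI)+
  have closed: "x + y \<in> range of_cx" "x * y \<in> range of_cx"
    if "x \<in> range of_cx" "y \<in> range of_cx" for x y :: "'n cclifford"
    using that by (auto simp flip: of_cx_add of_cx_mult)
  have closed_scaleR: "r *\<^sub>R x \<in> range of_cx" if "x \<in> range of_cx" for x :: "'n cclifford" and r
    using that by (auto simp flip: of_cx_scaleR)
  show ?thesis
    by standard (use extensional zero_closed one_closed add_closed mult_closed scaleR_closed in
        \<open>auto simp: scalar_stem_def range closed closed_scaleR\<close>)
qed

section \<open>Transport of the algebraic structure to paravectors\<close>

lemma sigma_ext_extensional: "sigma_ext \<Omega> F \<in> extensional \<Omega>"
  by (simp add: sigma_ext_def)

context
  fixes \<Omega> :: "'n::len0 cclifford set"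
  assumes paravectors: "\<Omega> \<subseteq> paravectors"
begin

text \<open>Restricting to \<open>spectra \<Omega>\<close> is harmless: at
  \<open>\<kappa> \<in> \<Omega>\<close> only the values at the two spectral points of
  \<open>\<kappa>\<close> are read.\<close>

lemma sigma_ext_restrict:
  "sigma_ext \<Omega> (\<lambda>\<zeta>\<in>spectra \<Omega>. F \<zeta>) = (\<lambda>\<kappa>\<in>\<Omega>. F (s_plus \<kappa>) * spec_proj \<kappa> + F (s_minus \<kappa>) * (1 - spec_proj \<kappa>))"
  using paravectors
  by (intro extensionalityI[OF sigma_ext_extensional])
    (auto simp: sigma_ext_apply s_plus_in_spectra s_minus_in_spectra subset_iff)

lemma sigma_ext_add:
  "sigma_ext \<Omega> (\<lambda>\<zeta>\<in>spectra \<Omega>. F \<zeta> + G \<zeta>) = (\<lambda>\<kappa>\<in>\<Omega>. sigma_ext \<Omega> F \<kappa> + sigma_ext \<Omega> G \<kappa>)"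
  unfolding sigma_ext_restrict using paravectors
  by (intro restrict_ext) (simp add: sigma_ext_apply subset_iff algebra_simps)

lemma sigma_ext_scaleR:
  "sigma_ext \<Omega> (\<lambda>\<zeta>\<in>spectra \<Omega>. r *\<^sub>R F \<zeta>) = (\<lambda>\<kappa>\<in>\<Omega>. r *\<^sub>R sigma_ext \<Omega> F \<kappa>)"
  unfolding sigma_ext_restrict using paravectors
  by (intro restrict_ext) (simp add: sigma_ext_apply subset_iff algebra_simps)

lemma sigma_ext_one: "sigma_ext \<Omega> (\<lambda>\<zeta>\<in>spectra \<Omega>. 1) = (\<lambda>\<kappa>\<in>\<Omega>. 1)"
  unfolding sigma_ext_restrict by simp

text \<open>The values of \<open>f\<close> are central, so they can be pulled past the projections
  of \<open>F\<close>; the cross terms vanish by \<open>p * (1 - p) = 0\<close>.\<close>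

lemma sigma_ext_mult:
  assumes f: "f \<in> scalar_stem (spectra \<Omega>)"
  shows "sigma_ext \<Omega> (\<lambda>\<zeta>\<in>spectra \<Omega>. F \<zeta> * f \<zeta>) = (\<lambda>\<kappa>\<in>\<Omega>. sigma_ext \<Omega> F \<kappa> * sigma_ext \<Omega> f \<kappa>)"
  unfolding sigma_ext_restrict
proof (intro restrict_ext)
  fix \<kappa> assume \<kappa>: "\<kappa> \<in> \<Omega>"
  define p where "p = spec_proj \<kappa>"
  have "f (s_plus \<kappa>) \<in> range of_cx" "f (s_minus \<kappa>) \<in> range of_cx"
    using f \<kappa> by (auto simp: scalar_stem_def s_plus_in_spectra s_minus_in_spectra)
  then obtain c d where c: "f (s_plus \<kappa>) = of_cx c" and d: "f (s_minus \<kappa>) = of_cx d"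
    by auto
  have "(F (s_plus \<kappa>) * p + F (s_minus \<kappa>) * (1 - p)) * (of_cx c * p + of_cx d * (1 - p)) =
      F (s_plus \<kappa>) * of_cx c * p + F (s_minus \<kappa>) * of_cx d * (1 - p)"
  proof (cases "im_part \<kappa> = 0")
    \<comment> \<open>Here \<open>p\<close> is \<open>1/2\<close> and not idempotent, but
      \<open>f\<close> and \<open>F\<close> each take one value on the spectrum, so both factors
      collapse.\<close>
    case True
    then have "s_minus \<kappa> = s_plus \<kappa>" by (simp add: s_plus_def s_minus_def)
    moreover from this have "of_cx d = (of_cx c :: 'n cclifford)" using c d by simp
    ultimately show ?thesis by (simp flip: distrib_left)
  next
    case False
    have move: "x * q * (of_cx c * q') = x * of_cx c * (q * q')" for x q q' :: "'n cclifford" and c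
      by (metis mult.assoc of_cx_central)
    have pp: "p * p = p" using False by (simp add: p_def spec_proj_idem)
    then have "p * (1 - p) = 0" "(1 - p) * p = 0" "(1 - p) * (1 - p) = 1 - p"
      by (simp_all add: algebra_simps)
    with pp show ?thesis by (simp only: distrib_left distrib_right move) simp
  qed
  then show "F (s_plus \<kappa>) * f (s_plus \<kappa>) * spec_proj \<kappa> + F (s_minus \<kappa>) * f (s_minus \<kappa>) * (1 - spec_proj \<kappa>)
      = sigma_ext \<Omega> F \<kappa> * sigma_ext \<Omega> f \<kappa>"
    using \<kappa> paravectors by (simp add: sigma_ext_apply subset_iff c d p_def)
qed

lemma pointwise_space_slice_regular: "pointwise_space \<Omega> (slice_regular \<Omega>)"
proof -
  interpret pointwise_algebra "spectra \<Omega>" "stem (spectra \<Omega>) :: (complex \<Rightarrow> 'n cclifford) set"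
    by (intro pointwise_algebra_stem spectra_cnj)
  show ?thesis unfolding slice_regular_def
    by (rule pointwise_space_image) (auto simp: sigma_ext_extensional sigma_ext_add sigma_ext_scaleR)
qed

lemma pointwise_algebra_intrinsic_regular: "pointwise_algebra \<Omega> (intrinsic_regular \<Omega>)"
proof -
  interpret pointwise_algebra "spectra \<Omega>" "scalar_stem (spectra \<Omega>) :: (complex \<Rightarrow> 'n cclifford) set"
    by (intro pointwise_algebra_scalar_stem spectra_cnj)
  interpret image: pointwise_space \<Omega> "intrinsic_regular \<Omega>" unfolding intrinsic_regular_def
    by (rule pointwise_space_image) (auto simp: sigma_ext_extensional sigma_ext_add sigma_ext_scaleR)
  show ?thesis
  proof
    show "(\<lambda>\<kappa>\<in>\<Omega>. 1) \<in> intrinsic_regular \<Omega>"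
      using one_closed by (auto simp: intrinsic_regular_def simp flip: sigma_ext_one)
    show "(\<lambda>\<kappa>\<in>\<Omega>. u \<kappa> * v \<kappa>) \<in> intrinsic_regular \<Omega>"
      if uv: "u \<in> intrinsic_regular \<Omega>" "v \<in> intrinsic_regular \<Omega>" for u v
    proof -
      obtain f g where f: "f \<in> scalar_stem (spectra \<Omega>)" "u = sigma_ext \<Omega> f"
        and g: "g \<in> scalar_stem (spectra \<Omega>)" "v = sigma_ext \<Omega> g"
        using uv by (auto simp: intrinsic_regular_def)
      show ?thesis
        unfolding intrinsic_regular_def f(2) g(2) sigma_ext_mult[OF g(1), symmetric]
        by (intro imageI mult_closed f g)
    qed
  qed
qed

text \<open>Commutation is immediate for the complex-valued stems and is carried over by
  multiplicativity of \<open>sigma_ext\<close>, applied in both orders.\<close>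

lemma intrinsic_regular_commute:
  assumes "u \<in> intrinsic_regular \<Omega>" "v \<in> intrinsic_regular \<Omega>" "\<kappa> \<in> \<Omega>"
  shows "u \<kappa> * v \<kappa> = v \<kappa> * u \<kappa>"
proof -
  obtain f g where f: "f \<in> scalar_stem (spectra \<Omega>)" "u = sigma_ext \<Omega> f"
    and g: "g \<in> scalar_stem (spectra \<Omega>)" "v = sigma_ext \<Omega> g"
    using assms by (auto simp: intrinsic_regular_def)
  have "f \<zeta> * g \<zeta> = g \<zeta> * f \<zeta>" if "\<zeta> \<in> spectra \<Omega>" for \<zeta>
    using f g that by (auto simp: scalar_stem_def) (metis imageE of_cx_central)
  then have "(\<lambda>\<zeta>\<in>spectra \<Omega>. f \<zeta> * g \<zeta>) = (\<lambda>\<zeta>\<in>spectra \<Omega>. g \<zeta> * f \<zeta>)" by auto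
  then have "(\<lambda>\<kappa>\<in>\<Omega>. u \<kappa> * v \<kappa>) = (\<lambda>\<kappa>\<in>\<Omega>. v \<kappa> * u \<kappa>)"
    unfolding f(2) g(2) by (simp only: sigma_ext_mult[OF f(1), symmetric] sigma_ext_mult[OF g(1), symmetric])
  from fun_cong[OF this, of \<kappa>] show ?thesis using assms(3) by simp
qed

lemma slice_regular_mult_intrinsic:
  assumes "u \<in> slice_regular \<Omega>" "v \<in> intrinsic_regular \<Omega>"
  shows "(\<lambda>\<kappa>\<in>\<Omega>. u \<kappa> * v \<kappa>) \<in> slice_regular \<Omega>"
proof -
  interpret pointwise_algebra "spectra \<Omega>" "stem (spectra \<Omega>) :: (complex \<Rightarrow> 'n cclifford) set"
    by (intro pointwise_algebra_stem spectra_cnj)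
  obtain F f where F: "F \<in> stem (spectra \<Omega>)" "u = sigma_ext \<Omega> F"
    and f: "f \<in> scalar_stem (spectra \<Omega>)" "v = sigma_ext \<Omega> f"
    using assms by (auto simp: slice_regular_def intrinsic_regular_def)
  have "(\<lambda>\<zeta>\<in>spectra \<Omega>. F \<zeta> * f \<zeta>) \<in> stem (spectra \<Omega>)"
    using F f scalar_stem_subset by (intro mult_closed) auto
  then show ?thesis
    unfolding slice_regular_def F(2) f(2) sigma_ext_mult[OF f(1), symmetric] by (rule imageI)
qed

end

section \<open>Injectivity by reflection\<close>

lemma reflect_paravector:
  fixes \<kappa> :: "'n::len0 cclifford"
  assumes "\<kappa> \<in> paravectors"
  obtains \<theta> where "\<theta> \<in> paravectors" "s_plus \<theta> = s_plus \<kappa>" "s_minus \<theta> = s_minus \<kappa>"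
    "spec_proj \<theta> = 1 - spec_proj \<kappa>"
proof
  \<comment> \<open>This keeps the real part and negates the imaginary part, hence also
    \<open>im_unit\<close>.\<close>
  let ?\<theta> = "of_real (2 * re_part \<kappa>) - \<kappa>"
  show "?\<theta> \<in> paravectors"
    using assms unfolding paravectors_def of_real_def
    by (intro span_diff span_scale) (auto intro: span_base)
  have re: "re_part ?\<theta> = re_part \<kappa>"
    by (simp add: re_part_def coeff_of_real del: of_real_mult)
  have im: "im_part ?\<theta> = - im_part \<kappa>"
    by (simp add: im_part_def coeff_of_real sum_negf del: of_real_mult)
  show "s_plus ?\<theta> = s_plus \<kappa>" "s_minus ?\<theta> = s_minus \<kappa>"
    by (simp_all only: s_plus_def s_minus_def re im norm_minus_cancel)
  show "spec_proj ?\<theta> = 1 - spec_proj \<kappa>"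
    unfolding one_minus_spec_proj by (simp add: spec_proj_def im_unit_def im del: of_real_mult)
qed

text \<open>Saturation puts the reflected paravector into \<open>\<Omega>\<close>. Evaluation there
  gives a second equation for the two unknown differences \<open>A\<close> and \<open>B\<close> of
  spectral values.\<close>

lemma inj_on_sigma_ext:
  fixes \<Omega> :: "'n::len0 cclifford set"
  assumes sat: "spectrally_saturated \<Omega>"
  shows "inj_on (sigma_ext \<Omega>) (extensional (spectra \<Omega>))"
proof (rule inj_onI, rule extensionalityI)
  fix F G :: "complex \<Rightarrow> 'n cclifford" and \<zeta>
  assume eq: "sigma_ext \<Omega> F = sigma_ext \<Omega> G" and "\<zeta> \<in> spectra \<Omega>"
  then obtain \<kappa> where \<kappa>: "\<kappa> \<in> \<Omega>" "\<zeta> = s_plus \<kappa> \<or> \<zeta> = s_minus \<kappa>"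
    by (auto simp: spectra_def spectrum_def)
  from sat have para: "\<Omega> \<subseteq> paravectors" by (simp add: spectrally_saturated_def)
  with \<kappa> have \<kappa>_para: "\<kappa> \<in> paravectors" by auto
  obtain \<theta> where \<theta>: "\<theta> \<in> paravectors" "s_plus \<theta> = s_plus \<kappa>" "s_minus \<theta> = s_minus \<kappa>"
    "spec_proj \<theta> = 1 - spec_proj \<kappa>"
    using reflect_paravector[OF \<kappa>_para] .
  have "spectrum \<theta> = spectrum \<kappa>" by (simp add: spectrum_def \<theta>)
  then have "\<theta> \<in> \<Omega>"
    using sat \<theta>(1) \<kappa>(1) unfolding spectrally_saturated_def by blast
  define p A B where "p = spec_proj \<kappa>" and "A = F (s_plus \<kappa>) - G (s_plus \<kappa>)"
    and "B = F (s_minus \<kappa>) - G (s_minus \<kappa>)"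
  have 1: "A * p + B * (1 - p) = 0"
    using fun_cong[OF eq, of \<kappa>] \<kappa>(1) \<kappa>_para
    by (simp add: sigma_ext_apply A_def B_def p_def algebra_simps)
  \<comment> \<open>The reflection has the same spectral points with \<open>p\<close> and
    \<open>1 - p\<close> exchanged.\<close>
  have 2: "A * (1 - p) + B * p = 0"
    using fun_cong[OF eq, of \<theta>] \<open>\<theta> \<in> \<Omega>\<close> \<theta>
    by (simp add: sigma_ext_apply A_def B_def p_def algebra_simps)
  have "A = 0 \<and> B = 0"
  \<comment> \<open>For real \<open>\<kappa>\<close> the two differences agree and the first
    equation already forces them to be 0.\<close>
  proof (cases "im_part \<kappa> = 0")
    case True
    then have "A = B" by (simp add: A_def B_def s_plus_def s_minus_def)
    with 1 show ?thesis by (simp flip: distrib_left)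
  next
    case False
    then have pp: "p * p = p" by (simp add: p_def spec_proj_idem)
    \<comment> \<open>Right multiplication by \<open>p\<close> removes the \<open>B\<close> term
      from the first equation; \<open>1 - p\<close> does the same for the second. The two surviving
      parts of \<open>A\<close> add up to \<open>A\<close>.\<close>
    have "A * p = (A * p + B * (1 - p)) * p"
      by (simp add: algebra_simps pp)
    moreover have "A * (1 - p) = (A * (1 - p) + B * p) * (1 - p)"
      by (simp add: algebra_simps pp)
    ultimately have "A * p = 0" "A * (1 - p) = 0" using 1 2 by simp_all
    then have "A = 0" by (simp add: algebra_simps)
    with 1 2 show ?thesis by (simp add: algebra_simps)
  qed
  with \<kappa>(2) show "F \<zeta> = G \<zeta>" by (auto simp: A_def B_def)
qed

theorem theorem4:
  fixes \<Omega> :: "'n::len0 cclifford set" and U :: "complex set"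
  assumes "openin (top_of_set paravectors) \<Omega>"
    and "spectrally_saturated \<Omega>"
    and "U = spectra \<Omega>"
  shows "Module.algebra real_ring (fun_algebra \<Omega> (intrinsic_regular \<Omega>)) \<and>
    right_module (fun_algebra \<Omega> (intrinsic_regular \<Omega>)) (fun_right_module \<Omega> (slice_regular \<Omega>)) \<and>
    (sigma_ext \<Omega> \<in> linear_iso (fun_algebra U (stem U)) (fun_algebra \<Omega> (slice_regular \<Omega>)) \<and>
     (\<forall>F\<in>stem U. \<forall>f\<in>scalar_stem U.
        sigma_ext \<Omega> (\<lambda>\<zeta>\<in>U. F \<zeta> * f \<zeta>) = (\<lambda>\<kappa>\<in>\<Omega>. sigma_ext \<Omega> F \<kappa> * sigma_ext \<Omega> f \<kappa>))) \<and>
    (sigma_ext \<Omega> \<in> ring_iso (fun_algebra U (scalar_stem U)) (fun_algebra \<Omega> (intrinsic_regular \<Omega>)) \<and>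
     sigma_ext \<Omega> \<in> linear_iso (fun_algebra U (scalar_stem U)) (fun_algebra \<Omega> (intrinsic_regular \<Omega>))) \<and>
    (\<forall>(m::nat) (a :: nat \<Rightarrow> 'n cclifford). (\<forall>k\<le>m. a k \<in> clifford_real) \<longrightarrow>
       (\<forall>\<kappa>\<in>paravectors.
          sigma_ext paravectors (\<lambda>\<zeta>. \<Sum>k\<le>m. a k * of_cx \<zeta> ^ k) \<kappa> = (\<Sum>k\<le>m. a k * \<kappa> ^ k) \<and>
          (\<Sum>k\<le>m. a k * \<kappa> ^ k) \<in> clifford_real))"
proof -
  have para: "\<Omega> \<subseteq> paravectors" using assms(2) by (simp add: spectrally_saturated_def)
  interpret M: pointwise_space \<Omega> "slice_regular \<Omega>"
    by (rule pointwise_space_slice_regular[OF para])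
  interpret R: pointwise_algebra \<Omega> "intrinsic_regular \<Omega>"
    by (rule pointwise_algebra_intrinsic_regular[OF para])
  have ext: "stem U \<subseteq> extensional (spectra \<Omega>)" by (auto simp: stem_def assms(3))
  \<comment> \<open>Surjectivity is built into the targets, which are defined as images; injectivity
    comes from saturation and extensionality of stem functions.\<close>
  have bij: "bij_betw (sigma_ext \<Omega>) (stem U) (slice_regular \<Omega>)"
    "bij_betw (sigma_ext \<Omega>) (scalar_stem U) (intrinsic_regular \<Omega>)"
    using inj_on_subset[OF inj_on_sigma_ext[OF assms(2)]] ext scalar_stem_subset[of U]
    by (auto simp: bij_betw_def slice_regular_def intrinsic_regular_def assms(3))
  have mult: "sigma_ext \<Omega> (\<lambda>\<zeta>\<in>U. F \<zeta> * f \<zeta>) = (\<lambda>\<kappa>\<in>\<Omega>. sigma_ext \<Omega> F \<kappa> * sigma_ext \<Omega> f \<kappa>)"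
    if "f \<in> scalar_stem U" for F f
    using sigma_ext_mult[OF para] that by (simp add: assms(3))
  note linear = sigma_ext_add[OF para] sigma_ext_scaleR[OF para]
  have "sigma_ext \<Omega> \<in> linear_iso (fun_algebra U (stem U)) (fun_algebra \<Omega> (slice_regular \<Omega>))"
    "sigma_ext \<Omega> \<in> linear_iso (fun_algebra U (scalar_stem U)) (fun_algebra \<Omega> (intrinsic_regular \<Omega>))"
    using bij linear by (auto simp: linear_iso_def fun_algebra_def assms(3))
  moreover have "sigma_ext \<Omega> \<in> ring_iso (fun_algebra U (scalar_stem U)) (fun_algebra \<Omega> (intrinsic_regular \<Omega>))"
    using bij(2) mult linear sigma_ext_one[OF para]
    by (auto simp: ring_iso_def ring_hom_def fun_algebra_def assms(3) dest: bij_betwE)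
  moreover have "(\<Sum>k\<le>m. a k * \<kappa> ^ k) \<in> clifford_real"
    if "\<forall>k\<le>m. a k \<in> clifford_real" "\<kappa> \<in> paravectors" for m a and \<kappa> :: "'n cclifford"
  proof -
    \<comment> \<open>Paravectors lie in the real Clifford algebra, which is closed under products;
      being a span, it is also closed under the outer sum.\<close>
    have "a k * \<kappa> ^ k \<in> clifford_real" if "k \<le> m" for k
      using that \<open>\<forall>k\<le>m. a k \<in> clifford_real\<close> \<open>\<kappa> \<in> paravectors\<close> paravectors_subset_clifford_real
      by (auto intro!: clifford_real_mult clifford_real_power)
    then show ?thesis unfolding clifford_real_def by (auto intro: span_sum)
  qed
  moreover have "Module.algebra real_ring (fun_algebra \<Omega> (intrinsic_regular \<Omega>))"
    by (rule R.algebra_fun_algebra) (rule intrinsic_regular_commute[OF para])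
  moreover have "right_module (fun_algebra \<Omega> (intrinsic_regular \<Omega>)) (fun_right_module \<Omega> (slice_regular \<Omega>))"
    by (rule R.right_module_fun[OF M.pointwise_space_axioms]) (rule slice_regular_mult_intrinsic[OF para])
  ultimately show ?thesis
    using mult by (simp add: sigma_ext_polynomial)
qed

end
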